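(* Let $r^m_n=r^m_n(u)$, $(n,m)\in\mathbb{Z}^2$, be the octahedral functions, and $p_{\rm v},p_{\rm e},p_{\rm f}$ the polynomials, defined in the context. For every $(n,m)\in\mathbb{Z}^2$, $r^m_n$ satisfies the Fuchsian differential equation $\mathcal{L}^m_n r^m_n=0$, where, with $D_u={\rm d}/{\rm d}u$, $$\mathcal{L}^m_n=D_u^2+\left[\frac{3/4-m}{u}+\frac{-4m}{u-1}+\frac{-3n(2u+14)}{u^2+14u+1}\right]D_u+(1+12m+12n)\,\frac{(2m+3n)(u^2+14u+1)-12n(3u+1)}{4u(u-1)(u^2+14u+1)}.$$ The characteristic exponents of $\mathcal{L}^m_n$ are $\{0,\frac14+m\}$ at $u=0$; $\{0,1+4m\}$ at $u=1$; $\{0,1+3n\}$ at each of $u=-(2\pm\sqrt3)^2$; and $\{-\frac14-3m-3n,\,-2m-3n\}$ at $u=\infty$ (all other points being ordinary). The function $r^m_n$ is the Frobenius solution associated to the zero characteristic exponent of the singular point $u=0$. Moreover, $r^m_n$ satisfies eight differential recurrences of the form $$K\,r^{m+\Delta m}_{n+\Delta n}=p_{\rm v}^{(-\sigma_{\rm v}+\varepsilon_{\rm v})/4}\,p_{\rm e}^{-\sigma_{\rm e}+\varepsilon_{\rm e}}\,p_{\rm f}^{-\sigma_{\rm f}+\varepsilon_{\rm f}}\,(4u^{3/4})\,\frac{{\rm d}}{{\rm d}u}\left[p_{\rm v}^{\sigma_{\rm v}/4}\,p_{\rm e}^{\sigma_{\rm e}}\,p_{\rm f}^{\sigma_{\rm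 f}}\, r^m_n\right],$$ with the following parameters $\Delta(n,m)$; $(\sigma_{\rm v},\sigma_{\rm e},\sigma_{\rm f})$; $(\varepsilon_{\rm v},\varepsilon_{\rm e},\varepsilon_{\rm f})$; $K$: 1. $(0,+1)$; $(-1-4m,\,0,\,\frac58+\frac32m-\frac32n)$; $(1,0,1)$; $K=-(1+4m)$. 2. $(0,-1)$; $(0,\,0,\,-\frac18-\frac32m-\frac32n)$; $(-3,0,1)$; $K=\frac{3(1+12m+12n)(7-12m+12n)}{4m-3}$. 3. $(+1,0)$; $(\frac76-2m+2n,\,0,\,-1-3n)$; $(1,0,1)$; $K=\frac16(7-12m+12n)$. 4. $(-1,0)$; $(-\frac16-2m-2n,\,0,\,0)$; $(1,0,-2)$; $K=-\frac16(1+12m+12n)$. 5. $(+1,+1)$; $(-1-4m,\,\frac{13}{12}+m+n,\,-1-3n)$; $(1,1,1)$; $K=-(1+4m)$. 6. $(-1,-1)$; $(0,\,-\frac1{12}-m-n,\,0)$; $(-3,1,-2)$; $K=\frac{3(1+12m+12n)(-11+12m+12n)}{4m-3}$. 7. $(-1,+1)$; $(-1-4m,\,\frac5{12}+m-n,\,0)$; $(1,1,-2)$; $K=-(1+4m)$. 8. $(+1,-1)$; $(0,\,\frac7{12}-m+n,\,-1-3n)$; $(-3,1,1)$; $K=\frac{3(-7+12m-12n)(-19+12m-12n)}{4m-3}$.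
   Context: ${}_2F_1$ is the Gauss hypergeometric function. Let $p_{\rm v}(u)=u(1-u)^4$, $p_{\rm e}(u)=(1+u)(1-34u+u^2)$, $p_{\rm f}(u)=1+14u+u^2$, and $R(u)=-108\,p_{\rm v}(u)/p_{\rm e}(u)^2=1-p_{\rm f}(u)^3/p_{\rm e}(u)^2$. For $(n,m)\in\mathbb{Z}^2$, the octahedral function $r^m_n$ is the rational function of $u$ that on a neighborhood of $u=0$ satisfies $${}_2F_1\!\left(-\tfrac1{24}-\tfrac m2-\tfrac n2,\ \tfrac{11}{24}-\tfrac m2-\tfrac n2;\ \tfrac34-m;\ R(u)\right)=p_{\rm e}(u)^{-1/12-m-n}\,r^m_n(u)$$ (with powers of $p_{\rm e}(u)$ equal to $1$ at $u=0$); $r^m_n(0)=1$. In $\Delta(n,m)=(\Delta n,\Delta m)$ the first component shifts $n$ and the second shifts $m$. In the recurrences, fractional powers may be taken positive for small $u>0$, with $p_{\rm v}^{1/4}=u^{1/4}(1-u)$; after differentiation all fractional powers cancel, so the recurrences are identities of rational functions. For special $(n,m)$ some of the listed singular points may be ordinary points. *)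

theory Defs
  imports "HOL-Analysis.Analysis"
begin

definition hyp2F1 :: "complex \<Rightarrow> complex \<Rightarrow> complex \<Rightarrow> complex \<Rightarrow> complex" where
  "hyp2F1 a b c z = eval_fps (fps_hypergeo [a, b] [c] 1) z"

lemma hyp2F1_series:
  "hyp2F1 a b c z =
     (\<Sum>k. pochhammer a k * pochhammer b k / (pochhammer c k * fact k) * z ^ k)"
  by (simp add: hyp2F1_def eval_fps_def fps_hypergeo_def)

definition p_v :: "complex \<Rightarrow> complex" where
  "p_v u = u * (1 - u) ^ 4"

definition p_e :: "complex \<Rightarrow> complex" where
  "p_e u = (1 + u) * (1 - 34 * u + u ^ 2)"

definition p_f :: "complex \<Rightarrow> complex" where
  "p_f u = 1 + 14 * u + u ^ 2"

definition R_oct :: "complex \<Rightarrow> complex" where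
  "R_oct u = - 108 * p_v u / p_e u ^ 2"

lemma R_oct_alt: "p_e u \<noteq> 0 \<Longrightarrow> R_oct u = 1 - p_f u ^ 3 / p_e u ^ 2"
  unfolding R_oct_def p_v_def p_e_def p_f_def by (simp add: divide_simps) algebra

text \<open>
  A rational function is represented by the function it induces on the complex plane, in lowest
  terms. Since division by zero is zero, it takes the value 0 at its poles; two rational functions
  agreeing on a neighbourhood of a point are therefore equal everywhere.
\<close>

definition rational_function :: "(complex \<Rightarrow> complex) \<Rightarrow> bool" where
  "rational_function f \<longleftrightarrow>
     (\<exists>p q. q \<noteq> 0 \<and> coprime p q \<and> f = (\<lambda>u. poly p u / poly q u))"

text \<open>
  The function \<open>r\<^sub>n\<^sup>m\<close>. The principal power of \<open>p_e\<close> is holomorphic near \<open>u = 0\<close>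
  and equals 1 there.
\<close>

definition octahedral :: "int \<Rightarrow> int \<Rightarrow> complex \<Rightarrow> complex" where
  "octahedral n m = (THE r. rational_function r \<and>
     (\<forall>\<^sub>F u in nhds 0.
        hyp2F1 (- 1/24 - of_int m / 2 - of_int n / 2) (11/24 - of_int m / 2 - of_int n / 2)
               (3/4 - of_int m) (R_oct u)
        = p_e u powr (- 1/12 - of_int m - of_int n) * r u))"

text \<open>
  Second order operators \<open>D\<^sup>2 + P D + Q\<close> are given by their coefficient functions; the values of
  \<open>P\<close> and \<open>Q\<close> at their singularities are irrelevant in all definitions below.
\<close>

definition solves_ode ::
  "(complex \<Rightarrow> complex) \<Rightarrow> (complex \<Rightarrow> complex) \<Rightarrow> complex set \<Rightarrow> (complex \<Rightarrow> complex) \<Rightarrow> bool" where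
  "solves_ode P Q S y \<longleftrightarrow> y holomorphic_on S \<and>
     (\<forall>u\<in>S. (deriv ^^ 2) y u + P u * deriv y u + Q u * y u = 0)"

definition ordinary_point ::
  "(complex \<Rightarrow> complex) \<Rightarrow> (complex \<Rightarrow> complex) \<Rightarrow> complex \<Rightarrow> bool" where
  "ordinary_point P Q a \<longleftrightarrow>
     (\<exists>p q. p analytic_on {a} \<and> q analytic_on {a} \<and>
        (\<forall>\<^sub>F u in at a. P u = p u \<and> Q u = q u))"

text \<open>
  The indicial polynomial at an ordinary or regular singular point \<open>a\<close> is
  \<open>\<rho> (\<rho> - 1) + p(a) \<rho> + q(a)\<close>, where \<open>p = (u - a) P\<close> and \<open>q = (u - a)\<^sup>2 Q\<close> are analytic at \<open>a\<close>.
\<close>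

definition has_indicial_poly ::
  "(complex \<Rightarrow> complex) \<Rightarrow> (complex \<Rightarrow> complex) \<Rightarrow> complex \<Rightarrow> complex poly \<Rightarrow> bool" where
  "has_indicial_poly P Q a I \<longleftrightarrow>
     (\<exists>p q. p analytic_on {a} \<and> q analytic_on {a} \<and>
        (\<forall>\<^sub>F u in at a. P u = p u / (u - a) \<and> Q u = q u / (u - a) ^ 2) \<and>
        I = [:q a, p a - 1, 1:])"

definition char_exponents ::
  "(complex \<Rightarrow> complex) \<Rightarrow> (complex \<Rightarrow> complex) \<Rightarrow> complex \<Rightarrow> complex \<Rightarrow> complex \<Rightarrow> bool" where
  "char_exponents P Q a \<rho>1 \<rho>2 \<longleftrightarrow> has_indicial_poly P Q a ([:- \<rho>1, 1:] * [:- \<rho>2, 1:])"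

text \<open>
  Under \<open>u = 1/t\<close> the equation \<open>y'' + P y' + Q y = 0\<close> becomes
  \<open>y\<^sub>t\<^sub>t + (2/t - P(1/t)/t\<^sup>2) y\<^sub>t + Q(1/t)/t\<^sup>4 y = 0\<close>; the point \<open>u = \<infinity>\<close> is treated as \<open>t = 0\<close>.
\<close>

definition P_inf :: "(complex \<Rightarrow> complex) \<Rightarrow> complex \<Rightarrow> complex" where
  "P_inf P t = 2 / t - P (1 / t) / t ^ 2"

definition Q_inf :: "(complex \<Rightarrow> complex) \<Rightarrow> complex \<Rightarrow> complex" where
  "Q_inf Q t = Q (1 / t) / t ^ 4"

definition char_exponents_inf ::
  "(complex \<Rightarrow> complex) \<Rightarrow> (complex \<Rightarrow> complex) \<Rightarrow> complex \<Rightarrow> complex \<Rightarrow> bool" where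
  "char_exponents_inf P Q \<rho>1 \<rho>2 \<longleftrightarrow> char_exponents (P_inf P) (Q_inf Q) 0 \<rho>1 \<rho>2"

definition rational_coefficient :: "(complex \<Rightarrow> complex) \<Rightarrow> bool" where
  "rational_coefficient f \<longleftrightarrow>
     (\<exists>p q. q \<noteq> 0 \<and> (\<forall>u. poly q u \<noteq> 0 \<longrightarrow> f u = poly p u / poly q u))"

text \<open>Rational coefficients, and every point of the Riemann sphere ordinary or regular singular.\<close>

definition fuchsian :: "(complex \<Rightarrow> complex) \<Rightarrow> (complex \<Rightarrow> complex) \<Rightarrow> bool" where
  "fuchsian P Q \<longleftrightarrow> rational_coefficient P \<and> rational_coefficient Q \<and>
     (\<forall>a. \<exists>I. has_indicial_poly P Q a I) \<and> (\<exists>I. has_indicial_poly (P_inf P) (Q_inf Q) 0 I)"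

text \<open>
  A Frobenius solution \<open>(u - a)\<^sup>\<rho> (1 + c\<^sub>1 (u - a) + \<dots>)\<close> for the exponent \<open>\<rho> = 0\<close>. The equation is
  required on a punctured neighbourhood, since \<open>a\<close> itself is in general a singular point.
\<close>

definition frobenius_solution_zero ::
  "(complex \<Rightarrow> complex) \<Rightarrow> (complex \<Rightarrow> complex) \<Rightarrow> complex \<Rightarrow> (complex \<Rightarrow> complex) \<Rightarrow> bool" where
  "frobenius_solution_zero P Q a y \<longleftrightarrow> y analytic_on {a} \<and> y a = 1 \<and>
     (\<forall>\<^sub>F u in at a. (deriv ^^ 2) y u + P u * deriv y u + Q u * y u = 0)"

definition P_oct :: "int \<Rightarrow> int \<Rightarrow> complex \<Rightarrow> complex" where
  "P_oct n m u = (3/4 - of_int m) / u + (- 4 * of_int m) / (u - 1)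
     + (- 3 * of_int n * (2 * u + 14)) / (u ^ 2 + 14 * u + 1)"

definition Q_oct :: "int \<Rightarrow> int \<Rightarrow> complex \<Rightarrow> complex" where
  "Q_oct n m u = (1 + 12 * of_int m + 12 * of_int n) *
     (((2 * of_int m + 3 * of_int n) * (u ^ 2 + 14 * u + 1) - 12 * of_int n * (3 * u + 1))
      / (4 * u * (u - 1) * (u ^ 2 + 14 * u + 1)))"

text \<open>
  The differential recurrence for the shift \<open>(dn, dm)\<close> with the parameters
  \<open>(\<sigma>v, \<sigma>e, \<sigma>f)\<close>, \<open>(\<epsilon>v, \<epsilon>e, \<epsilon>f)\<close>, \<open>K\<close>. For small positive \<open>u\<close> the numbers
  \<open>u\<close>, \<open>p_v u\<close>, \<open>p_e u\<close>, \<open>p_f u\<close> are positive, so that all principal powers below are the positive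
  ones and are holomorphic near \<open>u\<close>. The left-hand side is a rational function; thus the right-hand
  side is the germ of that rational function, and an identity for all small \<open>u > 0\<close> is an identity
  of rational functions.
\<close>

definition octahedral_recurrence ::
  "int \<Rightarrow> int \<Rightarrow> int \<times> int \<Rightarrow> complex \<times> complex \<times> complex \<Rightarrow> complex \<times> complex \<times> complex \<Rightarrow>
   complex \<Rightarrow> bool" where
  "octahedral_recurrence n m = (\<lambda>(dn, dm) (\<sigma>v, \<sigma>e, \<sigma>f) (\<epsilon>v, \<epsilon>e, \<epsilon>f) K.
     \<forall>\<^sub>F x in at_right (0::real). let u = complex_of_real x in
       K * octahedral (n + dn) (m + dm) u =
         p_v u powr ((- \<sigma>v + \<epsilon>v) / 4) * p_e u powr (- \<sigma>e + \<epsilon>e) * p_f u powr (- \<sigma>f + \<epsilon>f)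
         * (4 * u powr (3/4))
         * deriv (\<lambda>w. p_v w powr (\<sigma>v / 4) * p_e w powr \<sigma>e * p_f w powr \<sigma>f * octahedral n m w) u)"

end

theory Submission
  imports Defs "HOL-Complex_Analysis.Complex_Analysis"
begin

text \<open>
  Each recurrence applies a first-order operator \<open>T = B (D + g)\<close> with rational \<open>B\<close> and \<open>g\<close>. The eight
  operators form four pairs of opposite shifts, and for such a pair \<open>T\<close>, \<open>T' = B' (D + g')\<close> one has
  \<open>T' T = c + B B' L\<close> with a constant \<open>c \<noteq> 0\<close>, where \<open>L\<close> is the second-order operator at the starting parameters. Hence \<open>T\<close> maps
  solutions of \<open>L r = 0\<close> to solutions at the shifted parameters. The constant \<open>K\<close> is the value at
  \<open>u = 0\<close> of \<open>T r\<close> for \<open>r = 1 + O(u)\<close>, and it never vanishes. Starting from \<open>r = 1\<close> at \<open>n = m = 0\<close>, this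
  produces for all \<open>(n, m)\<close> a rational solution, with poles at most at the nonzero singular points.
  Since the exponents \<open>0\<close> and \<open>1/4 + m\<close> at the origin do not differ by an integer, the holomorphic
  solution with value 1 at the origin is unique; by the pullback of the hypergeometric equation along \<open>R\<close>
  it is also \<open>p_e\<^sup>1\<^sup>/\<^sup>1\<^sup>2\<^sup>+\<^sup>m\<^sup>+\<^sup>n\<close> times the hypergeometric function, so the rational solution is the
  octahedral function.
\<close>

section \<open>Ladder operators\<close>

text \<open>The powers in the recurrences are multivalued, and some steps involve
  \<open>p_e\<close>, whose zeros are ordinary points of the equation. Both difficulties disappear
  in the form \<open>B * (D + g)\<close>: \<open>g\<close> is the logarithmic derivative of the
  fractional power, and \<open>B\<close> carries a factor \<open>u\<close> or \<open>p_e\<close>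
  whenever \<open>g\<close> has a simple pole at the origin or at the zeros of \<open>p_e\<close>.
  Poles can therefore arise only at 1 and at the zeros of \<open>p_f\<close>. Evaluating
  \<open>T' T r = c r\<close> at the origin shows that \<open>c\<close> is the value of
  \<open>K\<close> for the step times the value of \<open>K\<close> for the opposite step at the
  shifted parameters. The linear factors of these constants and of their denominators are odd
  integers for integers \<open>n\<close> and \<open>m\<close>, so none of them vanishes: every step
  can be normalised, and every ladder can be reversed. Computations take place near the origin,
  where \<open>p_e\<close> has a holomorphic power and the hypergeometric series can be composed
  with \<open>R\<close>. The equation on the rest of the plane follows from the identity
  theorem.\<close>

definition p_e' :: "complex \<Rightarrow> complex" where "p_e' u = 3 * u ^ 2 - 66 * u - 33"

definition p_f' :: "complex \<Rightarrow> complex" where "p_f' u = 2 * u + 14"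

text \<open>Logarithmic derivative of \<open>u^(3/4 - M) * (1 - u)^(-4 * M) * p_f^(-3 * N)\<close>.
  The parameters are complex so that they can serve as indeterminates in polynomial
  identities.\<close>

definition P_cx :: "complex \<Rightarrow> complex \<Rightarrow> complex \<Rightarrow> complex" where
  "P_cx N M u = (3/4 - M) / u + 4 * M / (1 - u) - 3 * N * (p_f' u / p_f u)"

definition Q_cx :: "complex \<Rightarrow> complex \<Rightarrow> complex \<Rightarrow> complex" where
  "Q_cx N M u = - ((1 + 12 * M + 12 * N) * ((2 * M + 3 * N) * p_f u - 12 * N * (3 * u + 1))
     / (4 * u * (1 - u) * p_f u))"

lemma P_oct_eq: "P_oct n m u = P_cx (of_int n) (of_int m) u"
proof -
  have "- 4 * of_int m / (u - 1) = 4 * of_int m / (1 - u)"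
    by (metis minus_diff_eq minus_divide_divide mult_minus_left)
  thus ?thesis
    by (simp add: P_oct_def P_cx_def p_f_def p_f'_def add_ac)
qed

lemma Q_oct_eq: "Q_oct n m u = Q_cx (of_int n) (of_int m) u"
proof -
  have *: "4 * u * (u - 1) * (u ^ 2 + 14 * u + 1) = - (4 * u * (1 - u) * p_f u)"
    by (simp add: p_f_def algebra_simps)
  show ?thesis
    unfolding Q_oct_def Q_cx_def * by (simp add: p_f_def add_ac)
qed

text \<open>
  The logarithmic derivative of \<open>p_v\<^sup>s\<^sup>v\<^sup>/\<^sup>4 p_e\<^sup>s\<^sup>e p_f\<^sup>s\<^sup>f\<close>.
\<close>

definition dlog :: "complex \<Rightarrow> complex \<Rightarrow> complex \<Rightarrow> complex \<Rightarrow> complex" where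
  "dlog sv se sf u = sv / 4 * (1 / u - 4 / (1 - u)) + se * (p_e' u / p_e u) + sf * (p_f' u / p_f u)"

definition ddlog :: "complex \<Rightarrow> complex \<Rightarrow> complex \<Rightarrow> complex \<Rightarrow> complex" where
  "ddlog sv se sf u = sv / 4 * (- 1 / u ^ 2 - 4 / (1 - u) ^ 2)
     + se * (((6 * u - 66) * p_e u - p_e' u ^ 2) / p_e u ^ 2)
     + sf * ((2 * p_f u - p_f' u ^ 2) / p_f u ^ 2)"

text \<open>
  The radius is chosen below the zero \<open>17 - 12 sqrt 2 = 0.029\<dots>\<close> of \<open>p_e\<close>.
\<close>

definition disc :: "complex set" where "disc = ball 0 (1/100)"

lemma open_disc [simp]: "open disc" and zero_in_disc [simp]: "0 \<in> disc"
  by (simp_all add: disc_def)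

text \<open>Distance below 1 from the point 1 gives two facts at once: \<open>p_e\<close> has no
  zero on the disc, and it stays off the branch cut of the principal power.\<close>

lemma norm_p_e_minus_1: assumes "u \<in> disc" shows "norm (p_e u - 1) < 1"
proof -
  have n: "norm u \<le> 1/100" using assms by (simp add: disc_def)
  have "p_e u - 1 = u * ((u - 33) * u - 33)"
    by (simp add: p_e_def algebra_simps power2_eq_square)
  hence "norm (p_e u - 1) = norm u * norm ((u - 33) * u - 33)"
    by (simp add: norm_mult)
  also have "\<dots> \<le> 1/100 * (norm (u - 33) * norm u + 33)"
    using norm_triangle_ineq4[of "(u-33)*u" 33] n by (intro mult_mono) (simp_all add: norm_mult)
  also have "\<dots> \<le> 1/100 * ((1/100 + 33) * (1/100) + 33)"
    using n norm_triangle_ineq4[of u 33] by (intro mult_left_mono add_mono mult_mono) auto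
  finally show ?thesis by simp
qed

lemma norm_p_f_minus_1: assumes "u \<in> disc" shows "norm (p_f u - 1) < 1"
proof -
  have n: "norm u \<le> 1/100" using assms by (simp add: disc_def)
  have "p_f u - 1 = u * (u + 14)"
    by (simp add: p_f_def algebra_simps power2_eq_square)
  hence "norm (p_f u - 1) = norm u * norm (u + 14)"
    by (simp add: norm_mult)
  also have "norm (u + 14) \<le> norm u + 14"
    using norm_triangle_ineq[of u 14] by simp
  also have "norm u * (norm u + 14) \<le> (1/100) * (1/100 + 14)"
    using n by (intro mult_mono add_mono) auto
  finally show ?thesis by (simp add: mult_left_mono)
qed

lemma disc_nonzero:
  assumes "u \<in> disc"
  shows "1 - u \<noteq> 0" "p_e u \<noteq> 0" "p_f u \<noteq> 0" "u \<noteq> 1"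
  using assms norm_p_e_minus_1[OF assms] norm_p_f_minus_1[OF assms] by (auto simp: disc_def)

lemma p_e_deriv [derivative_intros]: "(p_e has_field_derivative p_e' u) (at u within A)"
  unfolding p_e_def [abs_def] p_e'_def
  by (auto intro!: derivative_eq_intros simp: algebra_simps power2_eq_square)

lemma p_f_deriv [derivative_intros]: "(p_f has_field_derivative p_f' u) (at u within A)"
  unfolding p_f_def [abs_def] p_f'_def by (auto intro!: derivative_eq_intros)

lemma p_e'_deriv: "(p_e' has_field_derivative 6 * u - 66) (at u within A)"
  unfolding p_e'_def [abs_def] by (auto intro!: derivative_eq_intros)

lemma p_f'_deriv: "(p_f' has_field_derivative 2) (at u within A)"
  unfolding p_f'_def [abs_def] by (auto intro!: derivative_eq_intros)

lemmas chain_derivs = p_e_deriv[THEN DERIV_chain2] p_f_deriv[THEN DERIV_chain2]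
  p_e'_deriv[THEN DERIV_chain2] p_f'_deriv[THEN DERIV_chain2]

lemma dlog_deriv:
  assumes "u \<noteq> 0" "1 - u \<noteq> 0" "p_e u \<noteq> 0" "p_f u \<noteq> 0"
  shows "(dlog sv se sf has_field_derivative ddlog sv se sf u) (at u)"
proof -
  have 1: "((\<lambda>u. 1 / u - 4 / (1 - u)) has_field_derivative (- 1 / u ^ 2 - 4 / (1 - u) ^ 2)) (at u)"
    using assms by (auto intro!: derivative_eq_intros simp: power2_eq_square)
  have 2: "((\<lambda>u. p_e' u / p_e u) has_field_derivative
      (((6 * u - 66) * p_e u - p_e' u ^ 2) / p_e u ^ 2)) (at u)"
    using assms by (auto intro!: derivative_eq_intros chain_derivs simp: power2_eq_square)
  have 3: "((\<lambda>u. p_f' u / p_f u) has_field_derivative ((2 * p_f u - p_f' u ^ 2) / p_f u ^ 2)) (at u)"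
    using assms by (auto intro!: derivative_eq_intros chain_derivs simp: power2_eq_square)
  show ?thesis
    unfolding dlog_def [abs_def] ddlog_def by (intro DERIV_add DERIV_cmult 1 2 3)
qed

text \<open>Writing each derivative as function times logarithmic derivative turns the product rule
  into addition.\<close>

lemma log_deriv_mult:
  fixes p q :: "complex \<Rightarrow> complex"
  assumes "(p has_field_derivative p u * a) (at u)" "(q has_field_derivative q u * b) (at u)"
  shows "((\<lambda>u. p u * q u) has_field_derivative p u * q u * (a + b)) (at u)"
  using DERIV_mult[OF assms] by (simp add: algebra_simps)

text \<open>
  The recurrence with \<open>(\<epsilon>v, \<epsilon>e, \<epsilon>f) = (4 k - 3, e, j)\<close> applies \<open>B (D + g)\<close> with \<open>B = step_factor k e j\<close>
  and \<open>g = dlog sv se sf\<close>; \<open>k\<close> is the exponent of \<open>u\<close> in \<open>p_v\<^sup>\<epsilon>\<^sup>v\<^sup>/\<^sup>4 u\<^sup>3\<^sup>/\<^sup>4\<close>.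
\<close>

definition step_factor :: "nat \<Rightarrow> nat \<Rightarrow> int \<Rightarrow> complex \<Rightarrow> complex" where
  "step_factor k e j u = 4 * u ^ k * (1 - u) powi (4 * int k - 3) * p_e u ^ e * p_f u powi j"

text \<open>The factor \<open>B\<close> is 4 times
  \<open>p_v^((4*k-3)/4) * u^(3/4) * p_e^e * p_f^j\<close>; the summand \<open>3 / (4 * u)\<close>
  comes from \<open>u^(3/4)\<close>, which \<open>dlog\<close> does not see.\<close>

lemma step_factor_deriv:
  assumes "u \<noteq> 0" "1 - u \<noteq> 0" "p_e u \<noteq> 0" "p_f u \<noteq> 0"
  shows "(step_factor k e j has_field_derivative
    step_factor k e j u * (dlog (4 * of_nat k - 3) (of_nat e) (of_int j) u + 3 / (4 * u))) (at u)"
proof -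
  have 1: "((\<lambda>u. u ^ k) has_field_derivative u ^ k * (of_nat k / u)) (at u)"
    using DERIV_power[OF DERIV_ident, where n = k] assms by (cases k) (simp_all add: mult.commute)
  have 2: "((\<lambda>u. (1 - u) powi i) has_field_derivative (1 - u) powi i * (- of_int i / (1 - u))) (at u)" for i
    using assms by (auto intro!: derivative_eq_intros simp: power_int_diff)
  have 3: "((\<lambda>u. p_e u ^ e) has_field_derivative p_e u ^ e * (of_nat e * (p_e' u / p_e u))) (at u)"
    using DERIV_power[OF p_e_deriv, where n = e] assms by (cases e) (simp_all add: mult_ac)
  have 4: "((\<lambda>u. p_f u powi j) has_field_derivative p_f u powi j * (of_int j * (p_f' u / p_f u))) (at u)"
    using assms by (auto intro!: derivative_eq_intros chain_derivs simp: power_int_diff)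
  have 0: "((\<lambda>u. 4) has_field_derivative 4 * 0) (at u)" by simp
  have "(step_factor k e j has_field_derivative step_factor k e j u *
     (0 + of_nat k / u + (- of_int (4 * int k - 3) / (1 - u)) + of_nat e * (p_e' u / p_e u)
       + of_int j * (p_f' u / p_f u))) (at u)"
    unfolding step_factor_def [abs_def] by (intro log_deriv_mult 0 1 2 3 4)
  also have "0 + of_nat k / u + (- of_int (4 * int k - 3) / (1 - u)) + of_nat e * (p_e' u / p_e u)
       + of_int j * (p_f' u / p_f u) = dlog (4 * of_nat k - 3) (of_nat e) (of_int j) u + 3 / (4 * u)"
    using assms by (simp add: dlog_def) (simp add: divide_simps, simp add: algebra_simps)
  finally show ?thesis .
qed

text \<open>Holomorphy is demanded at the origin as well, though the equation is not; for integer
  \<open>M\<close> this excludes solutions of exponent \<open>1/4 + M\<close>.\<close>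

definition sol_disc :: "complex \<Rightarrow> complex \<Rightarrow> (complex \<Rightarrow> complex) \<Rightarrow> bool" where
  "sol_disc N M r \<longleftrightarrow> r holomorphic_on disc \<and>
     (\<forall>u\<in>disc - {0}. deriv (deriv r) u + P_cx N M u * deriv r u + Q_cx N M u * r u = 0)"

text \<open>
  Let \<open>B'\<close> and \<open>g'\<close> belong to the opposite step. Together with \<open>P = g + g' + D B / B\<close>, which amounts
  to a linear relation between the exponents, this is the operator identity
  \<open>B' (D + g') B (D + g) = c + B B' (D\<^sup>2 + P D + Q)\<close>; only \<open>g\<close> enters after \<open>g'\<close> has been eliminated by means of \<open>P\<close>.
\<close>

definition ladder ::
  "complex \<Rightarrow> complex \<Rightarrow> complex \<Rightarrow> complex \<Rightarrow> complex \<Rightarrow> nat \<Rightarrow> int \<Rightarrow> nat \<Rightarrow> int \<Rightarrow> nat \<Rightarrow> complex \<Rightarrow> bool"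
where
  "ladder N M sv se sf k j k' j' e c \<longleftrightarrow> (\<forall>u. u \<noteq> 0 \<longrightarrow> 1 - u \<noteq> 0 \<longrightarrow> p_e u \<noteq> 0 \<longrightarrow> p_f u \<noteq> 0 \<longrightarrow>
     Q_cx N M u = ddlog sv se sf u + dlog sv se sf u * (P_cx N M u - dlog sv se sf u)
       - c / (step_factor k e j u * step_factor k' e j' u))"

text \<open>All terms are logarithmic derivatives of the same three factors, so only exponents have
  to be compared. The \<open>3/4\<close> in the exponent of \<open>u\<close> in \<open>P_cx\<close>
  is supplied by the extra \<open>3 / (4 * u)\<close> of the step factor.\<close>

lemma P_cx_dlog:
  assumes "u \<noteq> 0" "1 - u \<noteq> 0" "p_e u \<noteq> 0" "p_f u \<noteq> 0"
    and "sv + sv' + (4 * of_nat k - 3) = - 4 * M" "se + se' + of_nat e = 0" "sf + sf' + of_int j = - 3 * N"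
  shows "P_cx N M u = dlog sv se sf u + dlog sv' se' sf' u
           + (dlog (4 * of_nat k - 3) (of_nat e) (of_int j) u + 3 / (4 * u))"
proof -
  have "dlog sv se sf u + dlog sv' se' sf' u + (dlog (4 * of_nat k - 3) (of_nat e) (of_int j) u + 3 / (4 * u))
    = dlog (sv + sv' + (4 * of_nat k - 3)) (se + se' + of_nat e) (sf + sf' + of_int j) u + 3 / (4 * u)"
    unfolding dlog_def by (simp add: ring_distribs add_divide_distrib diff_divide_distrib)
  also have "\<dots> = P_cx N M u"
    unfolding assms dlog_def P_cx_def using assms(1,2) by (simp add: divide_simps) (simp add: algebra_simps)
  finally show ?thesis ..
qed

text \<open>
  Applying \<open>T = B (D + g)\<close> to \<open>T' T r = c r\<close> gives \<open>T T' s = c s\<close> for \<open>s = T r\<close>, which by the reverse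
  ladder is the differential equation for \<open>s\<close>.
\<close>

lemma ladder_step:
  assumes sol: "sol_disc N M r" and hol: "s holomorphic_on disc"
    and l1: "ladder N M sv se sf k j k' j' e c"
    and l2: "ladder N' M' sv' se' sf' k' j' k j e c" and c: "c \<noteq> 0"
    and sums: "sv + sv' + (4 * of_nat k - 3) = - 4 * M" "se + se' + of_nat e = 0"
      "sf + sf' + of_int j = - 3 * N"
    and sums': "sv' + sv + (4 * of_nat k' - 3) = - 4 * M'" "se' + se + of_nat e = 0"
      "sf' + sf + of_int j' = - 3 * N'"
    and s: "\<And>u. u \<in> disc - {0} \<Longrightarrow> s u = step_factor k e j u * (deriv r u + dlog sv se sf u * r u)"
  shows "sol_disc N' M' s"
  unfolding sol_disc_def
proof (intro conjI ballI hol)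
  define W where "W = disc - {0::complex}"
  have W: "open W" by (auto simp: W_def open_Diff)
  have nz: "u \<noteq> 0" "1 - u \<noteq> 0" "p_e u \<noteq> 0" "p_f u \<noteq> 0" if "u \<in> W" for u
    using that disc_nonzero[of u] by (auto simp: W_def)
  define B B' g g' where defs: "B = step_factor k e j" "B' = step_factor k' e j'"
    "g = dlog sv se sf" "g' = dlog sv' se' sf'"
  define b b' where bdefs: "b = (\<lambda>u. dlog (4 * of_nat k - 3) (of_nat e) (of_int j) u + 3 / (4 * u))"
    "b' = (\<lambda>u. dlog (4 * of_nat k' - 3) (of_nat e) (of_int j') u + 3 / (4 * u))"
  have BD: "(B has_field_derivative B u * b u) (at u)" "(B' has_field_derivative B' u * b' u) (at u)"
    if "u \<in> W" for u
    unfolding defs bdefs using step_factor_deriv[OF nz[OF that]] by blast+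
  have gD: "(g has_field_derivative ddlog sv se sf u) (at u)"
     "(g' has_field_derivative ddlog sv' se' sf' u) (at u)" if "u \<in> W" for u
    unfolding defs using dlog_deriv[OF nz[OF that]] by blast+
  have Bnz: "B u \<noteq> 0" "B' u \<noteq> 0" if "u \<in> W" for u
    using nz[OF that] by (auto simp: defs step_factor_def)
  have PP: "P_cx N M u = g u + g' u + b u" "P_cx N' M' u = g' u + g u + b' u" if "u \<in> W" for u
    using P_cx_dlog[OF nz[OF that] sums] P_cx_dlog[OF nz[OF that] sums'] by (simp_all add: defs bdefs)
  \<comment> \<open>By \<open>PP\<close>, the factor \<open>P - g\<close> of the ladder identity is
    \<open>g' + b\<close>, which brings the opposite step back in.\<close>
  have QQ: "Q_cx N M u = ddlog sv se sf u + g u * (g' u + b u) - c / (B u * B' u)"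
    "Q_cx N' M' u = ddlog sv' se' sf' u + g' u * (g u + b' u) - c / (B u * B' u)" if "u \<in> W" for u
    using l1 l2 nz[OF that] PP[OF that] unfolding ladder_def by (auto simp: defs mult.commute)
  have ode: "deriv (deriv r) u = - P_cx N M u * deriv r u - Q_cx N M u * r u" if "u \<in> W" for u
    using sol that unfolding sol_disc_def W_def by (auto simp: algebra_simps eq_neg_iff_add_eq_0)
  have rhol: "r holomorphic_on W" "s holomorphic_on W"
    using sol hol by (auto simp: sol_disc_def W_def intro: holomorphic_on_subset)
  have D: "(f has_field_derivative deriv f u) (at u)"
    if "f holomorphic_on W" "u \<in> W" for f u
    using that W by (metis holomorphic_derivI)
  have s': "s u = B u * (deriv r u + g u * r u)" if "u \<in> W" for u
    using s that by (simp add: defs W_def)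
  have s1: "deriv s u = B u * b u * (deriv r u + g u * r u)
         + B u * (deriv (deriv r) u + ddlog sv se sf u * r u + g u * deriv r u)" if u: "u \<in> W" for u
  proof -
    have "((\<lambda>u. B u * (deriv r u + g u * r u)) has_field_derivative
       (B u * b u * (deriv r u + g u * r u)
         + B u * (deriv (deriv r) u + ddlog sv se sf u * r u + g u * deriv r u))) (at u)"
      by (rule derivative_eq_intros BD(1)[OF u] gD(1)[OF u] D[OF rhol(1) u]
            D[OF holomorphic_deriv[OF rhol(1) W] u] refl | simp add: algebra_simps)+
    from has_field_derivative_transform_within_open[OF this W u, where g = s] show ?thesis
      by (intro DERIV_imp_deriv) (simp add: s')
  qed
  \<comment> \<open>This is \<open>T' T r = c r\<close>; the second derivative of \<open>r\<close>
    is removed by the equation for \<open>r\<close>.\<close>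
  have rs: "c * r u = B' u * (deriv s u + g' u * s u)" if u: "u \<in> W" for u
  proof -
    define x where "x = c / (B u * B' u)"
    have x: "c = x * (B u * B' u)" using Bnz[OF u] by (simp add: x_def)
    show ?thesis
      unfolding s1[OF u] s'[OF u] ode[OF u] QQ(1)[OF u] PP(1)[OF u] x_def [symmetric]
      unfolding x by algebra
  qed
  \<comment> \<open>Differentiating \<open>T' s = c r\<close> expresses \<open>deriv r\<close>
    through \<open>s\<close>, so \<open>T (c r)\<close> can be written in \<open>s\<close>
    alone.\<close>
  have drs: "c * deriv r u = B' u * b' u * (deriv s u + g' u * s u)
         + B' u * (deriv (deriv s) u + ddlog sv' se' sf' u * s u + g' u * deriv s u)" if u: "u \<in> W" for u
  proof -
    have "((\<lambda>u. B' u * (deriv s u + g' u * s u)) has_field_derivative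
       (B' u * b' u * (deriv s u + g' u * s u)
         + B' u * (deriv (deriv s) u + ddlog sv' se' sf' u * s u + g' u * deriv s u))) (at u)"
      by (rule derivative_eq_intros BD(2)[OF u] gD(2)[OF u] D[OF rhol(2) u]
            D[OF holomorphic_deriv[OF rhol(2) W] u] refl | simp add: algebra_simps)+
    from has_field_derivative_transform_within_open[OF this W u, where g = "\<lambda>u. c * r u"]
    have "((\<lambda>u. c * r u) has_field_derivative (B' u * b' u * (deriv s u + g' u * s u)
         + B' u * (deriv (deriv s) u + ddlog sv' se' sf' u * s u + g' u * deriv s u))) (at u)"
      by (simp add: rs)
    moreover have "((\<lambda>u. c * r u) has_field_derivative c * deriv r u) (at u)"
      by (intro DERIV_cmult D rhol u)
    ultimately show ?thesis by (metis DERIV_unique)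
  qed
  fix u assume "u \<in> disc - {0}"
  hence u: "u \<in> W" by (simp add: W_def)
  have "c * s u = B u * (c * deriv r u + g u * (c * r u))"
    by (simp add: s'[OF u] algebra_simps)
  hence "c * s u = B u * B' u * (deriv (deriv s) u + P_cx N' M' u * deriv s u + (Q_cx N' M' u + c / (B u * B' u)) * s u)"
    unfolding rs[OF u] drs[OF u] PP(2)[OF u] QQ(2)[OF u] by (simp add: algebra_simps)
  also have "\<dots> = B u * B' u * (deriv (deriv s) u + P_cx N' M' u * deriv s u + Q_cx N' M' u * s u) + c * s u"
    using Bnz[OF u] by (simp add: field_simps)
  finally show "deriv (deriv s) u + P_cx N' M' u * deriv s u + Q_cx N' M' u * s u = 0"
    using Bnz[OF u] by simp
qed

text \<open>
  Clearing denominators turns the ladder identities into polynomial identities in \<open>u\<close>, \<open>N\<close>, \<open>M\<close>.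
\<close>

definition dlog_num :: "complex \<Rightarrow> complex \<Rightarrow> complex \<Rightarrow> complex \<Rightarrow> complex" where
  "dlog_num sv se sf u = sv / 4 * (1 - 5 * u) * p_e u * p_f u
     + se * p_e' u * u * (1 - u) * p_f u + sf * p_f' u * u * (1 - u) * p_e u"

definition ddlog_num :: "complex \<Rightarrow> complex \<Rightarrow> complex \<Rightarrow> complex \<Rightarrow> complex" where
  "ddlog_num sv se sf u = sv / 4 * (- ((1 - u) ^ 2) - 4 * u ^ 2) * p_e u ^ 2 * p_f u ^ 2
     + se * ((6 * u - 66) * p_e u - p_e' u ^ 2) * u ^ 2 * (1 - u) ^ 2 * p_f u ^ 2
     + sf * (2 * p_f u - p_f' u ^ 2) * u ^ 2 * (1 - u) ^ 2 * p_e u ^ 2"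

definition P_num :: "complex \<Rightarrow> complex \<Rightarrow> complex \<Rightarrow> complex" where
  "P_num N M u = (3/4 - M) * (1 - u) * p_f u + 4 * M * u * p_f u - 3 * N * p_f' u * u * (1 - u)"

definition Q_num :: "complex \<Rightarrow> complex \<Rightarrow> complex \<Rightarrow> complex" where
  "Q_num N M u = - ((1 + 12 * M + 12 * N) / 4 * ((2 * M + 3 * N) * p_f u - 12 * N * (3 * u + 1)))"

lemma fractions:
  assumes "u \<noteq> 0" "1 - u \<noteq> 0" "p_e u \<noteq> 0" "p_f u \<noteq> 0"
  shows "dlog sv se sf u = dlog_num sv se sf u / (u * (1 - u) * p_e u * p_f u)"
    and "ddlog sv se sf u = ddlog_num sv se sf u / (u * (1 - u) * p_e u * p_f u) ^ 2"
    and "P_cx N M u = P_num N M u / (u * (1 - u) * p_f u)"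
    and "Q_cx N M u = Q_num N M u / (u * (1 - u) * p_f u)"
proof -
  define v where "v = 1 - u"
  have uv: "1 / u - 4 / v = (1 - 5 * u) / (u * v)" "- 1 / u ^ 2 - 4 / v ^ 2 = (- (v ^ 2) - 4 * u ^ 2) / (u ^ 2 * v ^ 2)"
    using assms(1,2) by (simp_all add: divide_simps v_def)
  note nz = assms[folded v_def]
  show "dlog sv se sf u = dlog_num sv se sf u / (u * (1 - u) * p_e u * p_f u)"
    unfolding dlog_def dlog_num_def v_def[symmetric] uv using nz
    by (simp add: add_divide_distrib)
  show "ddlog sv se sf u = ddlog_num sv se sf u / (u * (1 - u) * p_e u * p_f u) ^ 2"
    unfolding ddlog_def ddlog_num_def v_def[symmetric] uv using nz
    by (simp add: add_divide_distrib power_mult_distrib)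
  show "P_cx N M u = P_num N M u / (u * (1 - u) * p_f u)"
    unfolding P_cx_def P_num_def v_def[symmetric] using nz
    by (simp add: add_divide_distrib diff_divide_distrib)
  show "Q_cx N M u = Q_num N M u / (u * (1 - u) * p_f u)"
    unfolding Q_cx_def Q_num_def by simp
qed

lemma step_factor_prod:
  assumes "1 - u \<noteq> 0" "p_f u \<noteq> 0"
  shows "step_factor k e j u * step_factor k' e j' u =
    16 * u ^ (k + k') * (1 - u) powi (4 * int (k + k') - 6) * p_e u ^ (2 * e) * p_f u powi (j + j')"
proof -
  have e: "4 * int (k + k') - 6 = (4 * int k - 3) + (4 * int k' - 3)" by simp
  show ?thesis
    unfolding step_factor_def e power_int_add[OF disjI1[OF assms(1)]] power_int_add[OF disjI1[OF assms(2)]]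
    by (simp add: power_add mult_2)
qed

text \<open>The ladder identity is multiplied by the squared common denominator of
  \<open>dlog\<close>; \<open>w\<close> is the polynomial that this square leaves after division by
  \<open>B * B'\<close>. In the second assumption the four factors are independent nonzero
  variables, so it is pure bookkeeping of exponents.\<close>

lemma ladderI:
  assumes id: "\<And>u. dlog_num sv se sf u * P_num N M u * p_e u
      = Q_num N M u * u * (1 - u) * p_f u * p_e u ^ 2 - ddlog_num sv se sf u + dlog_num sv se sf u ^ 2
        + c * w u (1 - u) (p_e u) (p_f u)"
    and w: "\<And>u v y z. u \<noteq> 0 \<Longrightarrow> v \<noteq> 0 \<Longrightarrow> y \<noteq> 0 \<Longrightarrow> z \<noteq> 0 \<Longrightarrow>
      16 * u ^ (k + k') * v powi (4 * int (k + k') - 6) * y ^ (2 * e) * z powi (j + j') * w u v y z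
        = (u * v * y * z) ^ 2"
  shows "ladder N M sv se sf k j k' j' e c"
  unfolding ladder_def
proof (intro allI impI)
  fix u :: complex
  assume nz: "u \<noteq> 0" "1 - u \<noteq> 0" "p_e u \<noteq> 0" "p_f u \<noteq> 0"
  define x where "x = u * (1 - u) * p_f u"
  define B where "B = step_factor k e j u * step_factor k' e j' u"
  have x: "x \<noteq> 0" using nz by (simp add: x_def)
  have xe: "u * (1 - u) * p_e u * p_f u = x * p_e u" by (simp add: x_def)
  define w' where "w' = w u (1 - u) (p_e u) (p_f u)"
  have Bw: "B * w' = (x * p_e u) ^ 2"
    using w[OF nz] by (simp only: B_def w'_def step_factor_prod[OF nz(2,4)] xe)
  hence "B \<noteq> 0" "w' \<noteq> 0" using x nz by auto
  hence B: "c / B = c * w' / (x * p_e u) ^ 2"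
    unfolding Bw[symmetric] by simp
  have id': "dlog_num sv se sf u * P_num N M u * p_e u
      = Q_num N M u * x * p_e u ^ 2 - ddlog_num sv se sf u + dlog_num sv se sf u ^ 2 + c * w'"
    using id[of u] by (simp add: x_def w'_def algebra_simps)
  show "Q_cx N M u = ddlog sv se sf u + dlog sv se sf u * (P_cx N M u - dlog sv se sf u)
       - c / (step_factor k e j u * step_factor k' e j' u)"
    unfolding B_def[symmetric] B fractions[OF nz] xe x_def[symmetric]
    using x nz(3) id' by (simp add: field_simps power2_eq_square)
qed

section \<open>The eight ladder identities, in pairs of opposite steps\<close>

text \<open>The constant is \<open>K\<close> of this step times \<open>K\<close> of the opposite
  step at the target, which explains the shifted parameters in it. In the three kinds of pairs
  \<open>16 * w\<close> is \<open>p_v * p_e^2\<close>, \<open>p_e^2 * p_f^3\<close> or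
  \<open>p_v * p_f^3\<close>, products of the forms that define \<open>R\<close> and
  \<open>1 - R\<close>. As long as \<open>se = 0\<close> and \<open>e = 0\<close>,
  \<open>p_e\<close> is only a common factor and stays folded.\<close>

lemma ladder_m_up:
  "ladder N M (-1-4*M) (0) (5/8+3/2*M-3/2*N) 1 1 0 1 0 (-3*(1+12*(M+1)+12*N)*(7-12*(M+1)+12*N))"
proof (rule ladderI[where w = "\<lambda>u v y z. u * v ^ 4 * y ^ 2 / 16"])
  show "dlog_num (-1-4*M) (0) (5/8+3/2*M-3/2*N) u * P_num N M u * p_e u
      = Q_num N M u * u * (1 - u) * p_f u * p_e u ^ 2 - ddlog_num (-1-4*M) (0) (5/8+3/2*M-3/2*N) u
        + dlog_num (-1-4*M) (0) (5/8+3/2*M-3/2*N) u ^ 2 + -3*(1+12*(M+1)+12*N)*(7-12*(M+1)+12*N) * (u * (1 - u) ^ 4 * p_e u ^ 2 / 16)" for u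
    unfolding dlog_num_def ddlog_num_def P_num_def Q_num_def p_f_def p_f'_def by algebra
qed (simp add: power_int_minus field_simps eval_nat_numeral)

lemma ladder_m_down:
  "ladder N M (0) (0) (-1/8-3/2*M-3/2*N) 0 1 1 1 0 (-3*(1+12*M+12*N)*(7-12*M+12*N))"
proof (rule ladderI[where w = "\<lambda>u v y z. u * v ^ 4 * y ^ 2 / 16"])
  show "dlog_num (0) (0) (-1/8-3/2*M-3/2*N) u * P_num N M u * p_e u
      = Q_num N M u * u * (1 - u) * p_f u * p_e u ^ 2 - ddlog_num (0) (0) (-1/8-3/2*M-3/2*N) u
        + dlog_num (0) (0) (-1/8-3/2*M-3/2*N) u ^ 2 + -3*(1+12*M+12*N)*(7-12*M+12*N) * (u * (1 - u) ^ 4 * p_e u ^ 2 / 16)" for u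
    unfolding dlog_num_def ddlog_num_def P_num_def Q_num_def p_f_def p_f'_def by algebra
qed (simp add: power_int_minus field_simps eval_nat_numeral)

lemma ladder_n_up:
  "ladder N M (7/6-2*M+2*N) (0) (-1-3*N) 1 1 1 (-2) 0 (-1/36*(7-12*M+12*N)*(1+12*M+12*(N+1)))"
proof (rule ladderI[where w = "\<lambda>u v y z. y ^ 2 * z ^ 3 / 16"])
  show "dlog_num (7/6-2*M+2*N) (0) (-1-3*N) u * P_num N M u * p_e u
      = Q_num N M u * u * (1 - u) * p_f u * p_e u ^ 2 - ddlog_num (7/6-2*M+2*N) (0) (-1-3*N) u
        + dlog_num (7/6-2*M+2*N) (0) (-1-3*N) u ^ 2 + -1/36*(7-12*M+12*N)*(1+12*M+12*(N+1)) * (p_e u ^ 2 * p_f u ^ 3 / 16)" for u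
    unfolding dlog_num_def ddlog_num_def P_num_def Q_num_def p_f_def p_f'_def by algebra
qed (simp add: power_int_minus field_simps eval_nat_numeral)

lemma ladder_n_down:
  "ladder N M (-1/6-2*M-2*N) (0) (0) 1 (-2) 1 1 0 (-1/36*(1+12*M+12*N)*(7-12*M+12*(N-1)))"
proof (rule ladderI[where w = "\<lambda>u v y z. y ^ 2 * z ^ 3 / 16"])
  show "dlog_num (-1/6-2*M-2*N) (0) (0) u * P_num N M u * p_e u
      = Q_num N M u * u * (1 - u) * p_f u * p_e u ^ 2 - ddlog_num (-1/6-2*M-2*N) (0) (0) u
        + dlog_num (-1/6-2*M-2*N) (0) (0) u ^ 2 + -1/36*(1+12*M+12*N)*(7-12*M+12*(N-1)) * (p_e u ^ 2 * p_f u ^ 3 / 16)" for u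
    unfolding dlog_num_def ddlog_num_def P_num_def Q_num_def p_f_def p_f'_def by algebra
qed (simp add: power_int_minus field_simps eval_nat_numeral)

text \<open>Now \<open>g\<close> has poles at the zeros of \<open>p_e\<close>, so \<open>p_e\<close>
  no longer factors out and has to be unfolded.\<close>

lemma ladder_nm_up:
  "ladder N M (-1-4*M) (13/12+M+N) (-1-3*N) 1 1 0 (-2) 1 (-3*(1+12*(M+1)+12*(N+1))*(-11+12*(M+1)+12*(N+1)))"
proof (rule ladderI[where w = "\<lambda>u v y z. u * v ^ 4 * z ^ 3 / 16"])
  show "dlog_num (-1-4*M) (13/12+M+N) (-1-3*N) u * P_num N M u * p_e u
      = Q_num N M u * u * (1 - u) * p_f u * p_e u ^ 2 - ddlog_num (-1-4*M) (13/12+M+N) (-1-3*N) u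
        + dlog_num (-1-4*M) (13/12+M+N) (-1-3*N) u ^ 2 + -3*(1+12*(M+1)+12*(N+1))*(-11+12*(M+1)+12*(N+1)) * (u * (1 - u) ^ 4 * p_f u ^ 3 / 16)" for u
    unfolding dlog_num_def ddlog_num_def P_num_def Q_num_def p_f_def p_f'_def p_e_def p_e'_def by algebra
qed (simp add: power_int_minus field_simps eval_nat_numeral)

lemma ladder_nm_down:
  "ladder N M (0) (-1/12-M-N) (0) 0 (-2) 1 1 1 (-3*(1+12*M+12*N)*(-11+12*M+12*N))"
proof (rule ladderI[where w = "\<lambda>u v y z. u * v ^ 4 * z ^ 3 / 16"])
  show "dlog_num (0) (-1/12-M-N) (0) u * P_num N M u * p_e u
      = Q_num N M u * u * (1 - u) * p_f u * p_e u ^ 2 - ddlog_num (0) (-1/12-M-N) (0) u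
        + dlog_num (0) (-1/12-M-N) (0) u ^ 2 + -3*(1+12*M+12*N)*(-11+12*M+12*N) * (u * (1 - u) ^ 4 * p_f u ^ 3 / 16)" for u
    unfolding dlog_num_def ddlog_num_def P_num_def Q_num_def p_f_def p_f'_def p_e_def p_e'_def by algebra
qed (simp add: power_int_minus field_simps eval_nat_numeral)

lemma ladder_n_down_m_up:
  "ladder N M (-1-4*M) (5/12+M-N) (0) 1 (-2) 0 1 1 (-3*(-7+12*(M+1)-12*(N-1))*(-19+12*(M+1)-12*(N-1)))"
proof (rule ladderI[where w = "\<lambda>u v y z. u * v ^ 4 * z ^ 3 / 16"])
  show "dlog_num (-1-4*M) (5/12+M-N) (0) u * P_num N M u * p_e u
      = Q_num N M u * u * (1 - u) * p_f u * p_e u ^ 2 - ddlog_num (-1-4*M) (5/12+M-N) (0) u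
        + dlog_num (-1-4*M) (5/12+M-N) (0) u ^ 2 + -3*(-7+12*(M+1)-12*(N-1))*(-19+12*(M+1)-12*(N-1)) * (u * (1 - u) ^ 4 * p_f u ^ 3 / 16)" for u
    unfolding dlog_num_def ddlog_num_def P_num_def Q_num_def p_f_def p_f'_def p_e_def p_e'_def by algebra
qed (simp add: power_int_minus field_simps eval_nat_numeral)

lemma ladder_n_up_m_down:
  "ladder N M (0) (7/12-M+N) (-1-3*N) 0 1 1 (-2) 1 (-3*(-7+12*M-12*N)*(-19+12*M-12*N))"
proof (rule ladderI[where w = "\<lambda>u v y z. u * v ^ 4 * z ^ 3 / 16"])
  show "dlog_num (0) (7/12-M+N) (-1-3*N) u * P_num N M u * p_e u
      = Q_num N M u * u * (1 - u) * p_f u * p_e u ^ 2 - ddlog_num (0) (7/12-M+N) (-1-3*N) u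
        + dlog_num (0) (7/12-M+N) (-1-3*N) u ^ 2 + -3*(-7+12*M-12*N)*(-19+12*M-12*N) * (u * (1 - u) ^ 4 * p_f u ^ 3 / 16)" for u
    unfolding dlog_num_def ddlog_num_def P_num_def Q_num_def p_f_def p_f'_def p_e_def p_e'_def by algebra
qed (simp add: power_int_minus field_simps eval_nat_numeral)

section \<open>Rational functions with poles at the nonzero singular points\<close>

definition reg :: "complex set" where "reg = {u. 1 - u \<noteq> 0 \<and> p_f u \<noteq> 0}"

text \<open>Only values on \<open>reg\<close> matter and the fraction need not be reduced, so the
  class is closed under the arithmetic operations and the derivative.
  \<open>rational_function\<close> fixes a default value at the poles and lacks this
  convenience.\<close>

definition regular_rational :: "(complex \<Rightarrow> complex) \<Rightarrow> bool" where
  "regular_rational f \<longleftrightarrow> (\<exists>p q. \<forall>u\<in>reg. poly q u \<noteq> 0 \<and> f u = poly p u / poly q u)"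

lemma open_reg: "open reg"
  unfolding reg_def p_f_def by (intro open_Collect_conj open_Collect_neq continuous_intros)

lemma disc_subset_reg: "disc \<subseteq> reg"
  using disc_nonzero by (auto simp: reg_def)

lemma regular_rational_poly: "regular_rational (poly p)"
  unfolding regular_rational_def by (intro exI[of _ p] exI[of _ 1]) simp

lemma regular_rational_mult:
  assumes "regular_rational f" "regular_rational g"
  shows "regular_rational (\<lambda>u. f u * g u)"
proof -
  obtain p q where 1: "\<forall>u\<in>reg. poly q u \<noteq> 0 \<and> f u = poly p u / poly q u"
    using assms(1) unfolding regular_rational_def by blast
  obtain p' q' where 2: "\<forall>u\<in>reg. poly q' u \<noteq> 0 \<and> g u = poly p' u / poly q' u"
    using assms(2) unfolding regular_rational_def by blast
  show ?thesis
    unfolding regular_rational_def using 1 2 by (intro exI[of _ "p * p'"] exI[of _ "q * q'"]) simp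
qed

lemma regular_rational_add:
  assumes "regular_rational f" "regular_rational g"
  shows "regular_rational (\<lambda>u. f u + g u)"
proof -
  obtain p q where 1: "\<forall>u\<in>reg. poly q u \<noteq> 0 \<and> f u = poly p u / poly q u"
    using assms(1) unfolding regular_rational_def by blast
  obtain p' q' where 2: "\<forall>u\<in>reg. poly q' u \<noteq> 0 \<and> g u = poly p' u / poly q' u"
    using assms(2) unfolding regular_rational_def by blast
  show ?thesis
    unfolding regular_rational_def using 1 2
    by (intro exI[of _ "p * q' + p' * q"] exI[of _ "q * q'"]) (simp add: add_frac_eq)
qed

lemma regular_rational_deriv:
  assumes "regular_rational f"
  shows "regular_rational (deriv f)"
proof -
  obtain p q where 1: "\<forall>u\<in>reg. poly q u \<noteq> 0 \<and> f u = poly p u / poly q u"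
    using assms(1) unfolding regular_rational_def by blast
  have "deriv f u = poly (pderiv p * q - p * pderiv q) u / poly (q * q) u" if u: "u \<in> reg" for u
  proof -
    have "((\<lambda>u. poly p u / poly q u) has_field_derivative
        poly (pderiv p * q - p * pderiv q) u / poly (q * q) u) (at u)"
      using 1 u by (auto intro!: derivative_eq_intros simp: algebra_simps)
    from has_field_derivative_transform_within_open[OF this open_reg u, where g = f]
    show ?thesis using 1 by (intro DERIV_imp_deriv) auto
  qed
  thus ?thesis
    unfolding regular_rational_def using 1
    by (intro exI[of _ "pderiv p * q - p * pderiv q"] exI[of _ "q * q"]) auto
qed

lemma regular_rational_holomorphic:
  assumes "regular_rational f"
  shows "f holomorphic_on reg"
proof -
  obtain p q where 1: "\<forall>u\<in>reg. poly q u \<noteq> 0 \<and> f u = poly p u / poly q u"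
    using assms(1) unfolding regular_rational_def by blast
  have "(\<lambda>u. poly p u / poly q u) holomorphic_on reg"
    using 1 by (intro holomorphic_intros) auto
  thus ?thesis using 1 by (subst holomorphic_cong[OF refl]) auto
qed

lemma regular_rational_const [simp]: "regular_rational (\<lambda>u. c)"
proof -
  have "poly [:c:] = (\<lambda>u. c)" by (simp add: fun_eq_iff)
  thus ?thesis using regular_rational_poly[of "[:c:]"] by simp
qed

lemma regular_rational_id [simp]: "regular_rational (\<lambda>u. u)"
proof -
  have "poly [:0, 1:] = (\<lambda>u :: complex. u)" by (simp add: fun_eq_iff)
  thus ?thesis using regular_rational_poly[of "[:0, 1:]"] by simp
qed

lemma regular_rational_power: "regular_rational f \<Longrightarrow> regular_rational (\<lambda>u. f u ^ n)"
  by (induction n) (simp_all add: regular_rational_mult)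

lemma regular_rational_diff:
  assumes "regular_rational f" "regular_rational g"
  shows "regular_rational (\<lambda>u. f u - g u)"
  using regular_rational_add[OF assms(1) regular_rational_mult[OF regular_rational_const[of "- 1"] assms(2)]]
  by simp

lemma regular_rational_power_int:
  assumes "regular_rational f" "\<And>u. u \<in> reg \<Longrightarrow> f u \<noteq> 0"
  shows "regular_rational (\<lambda>u. f u powi j)"
proof (cases "j \<ge> 0")
  case True
  thus ?thesis using regular_rational_power[OF assms(1)] by (simp add: power_int_def)
next
  case False
  obtain p q where 1: "\<forall>u\<in>reg. poly q u \<noteq> 0 \<and> f u = poly p u / poly q u"
    using assms(1) unfolding regular_rational_def by blast
  have "regular_rational (\<lambda>u. inverse (f u))"
    unfolding regular_rational_def using 1 assms(2)
    by (intro exI[of _ q] exI[of _ p]) auto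
  from regular_rational_power[OF this] False show ?thesis by (simp add: power_int_def)
qed

lemmas regular_rational_intros = regular_rational_mult regular_rational_add regular_rational_diff
  regular_rational_power regular_rational_const regular_rational_id

lemma regular_rational_pow_factors:
  "regular_rational (\<lambda>u. (1 - u) powi i)" "regular_rational (\<lambda>u. p_f u powi j)"
proof -
  have "regular_rational p_f"
    unfolding p_f_def [abs_def] by (intro regular_rational_intros)
  thus "regular_rational (\<lambda>u. p_f u powi j)"
    by (rule regular_rational_power_int) (simp add: reg_def)
  show "regular_rational (\<lambda>u. (1 - u) powi i)"
    by (intro regular_rational_power_int regular_rational_intros) (simp add: reg_def)
qed

section \<open>Uniqueness and existence of lowest terms\<close>

text \<open>A root of \<open>q\<close> is not a root of the coprime \<open>p\<close>; comparing
  multiplicities in \<open>p * q' = p' * q\<close> then forces it to be a root of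
  \<open>q'\<close>.\<close>

lemma lowest_terms_pole:
  fixes p q p' q' :: "complex poly"
  assumes eq: "p * q' = p' * q" and cop: "coprime p q" and "q \<noteq> 0" "q' \<noteq> 0" and root: "poly q u = 0"
  shows "poly q' u = 0"
proof -
  have no_common: "poly p u \<noteq> 0"
  proof
    assume "poly p u = 0"
    hence "is_unit [:-u, 1:]"
      using cop root by (auto simp: coprime_def poly_eq_0_iff_dvd)
    thus False by (simp add: is_unit_iff_degree)
  qed
  hence "p \<noteq> 0" by auto
  hence "p' \<noteq> 0" using eq \<open>q' \<noteq> 0\<close> by auto
  have "order u p + order u q' = order u p' + order u q"
    using eq \<open>p \<noteq> 0\<close> \<open>p' \<noteq> 0\<close> \<open>q \<noteq> 0\<close> \<open>q' \<noteq> 0\<close> by (simp flip: order_mult)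
  moreover have "order u p = 0" using no_common by (simp add: order_root)
  moreover have "order u q \<noteq> 0" using root \<open>q \<noteq> 0\<close> by (simp add: order_root)
  ultimately show ?thesis by (simp add: order_root)
qed

lemma rational_function_unique:
  assumes "rational_function f" "rational_function g" "eventually (\<lambda>u. f u = g u) (nhds a)"
  shows "f = g"
proof -
  obtain p q where f: "q \<noteq> 0" "coprime p q" "f = (\<lambda>u. poly p u / poly q u)"
    using assms(1) unfolding rational_function_def by blast
  obtain p' q' where g: "q' \<noteq> 0" "coprime p' q'" "g = (\<lambda>u. poly p' u / poly q' u)"
    using assms(2) unfolding rational_function_def by blast
  have nz: "eventually (\<lambda>u. poly r u \<noteq> 0) (at a)" if "r \<noteq> 0" for r :: "complex poly"
    using islimpt_finite[OF poly_roots_finite[OF that], of a] by (simp add: islimpt_iff_eventually)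
  have "eventually (\<lambda>u. poly (p * q' - p' * q) u = 0) (at a)"
    using nz[OF f(1)] nz[OF g(1)] eventually_nhds_conv_at[THEN iffD1, OF assms(3), THEN conjunct1]
    by eventually_elim (simp add: f(3) g(3) field_simps)
  note ev = this
  have "p * q' - p' * q = 0"
  proof (rule ccontr)
    assume "p * q' - p' * q \<noteq> 0"
    from nz[OF this] ev have "eventually (\<lambda>u. False) (at a)"
      by eventually_elim simp
    thus False by simp
  qed
  hence eq: "p * q' = p' * q" by simp
  \<comment> \<open>At common zeros of the denominators both quotients have the default value 0, so
    agreement extends to the poles.\<close>
  have z: "poly q u = 0 \<longleftrightarrow> poly q' u = 0" for u
    using lowest_terms_pole[OF eq f(2) f(1) g(1)] lowest_terms_pole[OF eq[symmetric] g(2) g(1) f(1)] by blast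
  show "f = g"
  proof
    fix u
    have "poly p u * poly q' u = poly p' u * poly q u"
      using arg_cong[OF eq, of "\<lambda>x. poly x u"] by simp
    thus "f u = g u"
      using z[of u] unfolding f(3) g(3) by (cases "poly q u = 0") (simp_all add: frac_eq_eq)
  qed
qed

lemma poly_fraction_lowest_terms:
  fixes p q :: "complex poly"
  assumes "q \<noteq> 0"
  shows "\<exists>p' q' d. p = p' * d \<and> q = q' * d \<and> coprime p' q'"
  using assms
proof (induction "degree q" arbitrary: p q rule: less_induct)
  case less
  show ?case
  proof (cases "coprime p q")
    case True
    thus ?thesis by (intro exI[of _ p] exI[of _ q] exI[of _ 1]) simp
  next
    case False
    then obtain c where c: "c dvd p" "c dvd q" "\<not> is_unit c" by (rule not_coprimeE)
    then obtain a b where ab: "p = c * a" "q = c * b" by (auto elim!: dvdE)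
    have "b \<noteq> 0" "c \<noteq> 0" using less.prems ab by auto
    moreover have "degree c > 0" using c(3) \<open>c \<noteq> 0\<close> by (auto simp: is_unit_iff_degree)
    ultimately have "degree b < degree q" by (simp add: ab degree_mult_eq)
    from less.hyps[OF this \<open>b \<noteq> 0\<close>, of a] obtain p' q' d where
      "a = p' * d" "b = q' * d" "coprime p' q'" by blast
    thus ?thesis by (intro exI[of _ p'] exI[of _ q'] exI[of _ "d * c"]) (simp add: ab mult_ac)
  qed
qed

text \<open>Passage from the class convenient for differential operators to the one in which
  \<open>octahedral\<close> is defined; reduction may change values only off
  \<open>reg\<close>.\<close>

lemma regular_rational_lowest_terms:
  assumes "regular_rational f"
  obtains r where "rational_function r" "regular_rational r" "\<And>u. u \<in> reg \<Longrightarrow> r u = f u"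
proof -
  obtain p q where 1: "\<forall>u\<in>reg. poly q u \<noteq> 0 \<and> f u = poly p u / poly q u"
    using assms(1) unfolding regular_rational_def by blast
  have q: "q \<noteq> 0" using 1 disc_subset_reg zero_in_disc by (metis poly_0 subsetD)
  then obtain p' q' d where d: "p = p' * d" "q = q' * d" "coprime p' q'"
    using poly_fraction_lowest_terms by blast
  define r where "r = (\<lambda>u. poly p' u / poly q' u)"
  have *: "poly q' u \<noteq> 0 \<and> f u = r u" if "u \<in> reg" for u
    using 1 that by (auto simp: d r_def)
  show ?thesis
  proof (rule that)
    show "rational_function r"
      unfolding rational_function_def r_def using q d by (intro exI[of _ p'] exI[of _ q']) auto
    show "regular_rational r"
      unfolding regular_rational_def using * by (intro exI[of _ p'] exI[of _ q']) (simp add: r_def)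
    show "r u = f u" if "u \<in> reg" for u using *[OF that] by simp
  qed
qed

text \<open>
  The operator \<open>step_factor k e j * (D + dlog sv se sf)\<close> with its removable singularities at \<open>u = 0\<close>
  and at the zeros of \<open>p_e\<close> removed. The truncated exponents \<open>k - 1\<close> and \<open>e - 1\<close> are harmless, since
  \<open>sv = 0\<close> whenever \<open>k = 0\<close> and \<open>se = 0\<close> whenever \<open>e = 0\<close>.
\<close>

definition step_op ::
  "nat \<Rightarrow> nat \<Rightarrow> int \<Rightarrow> complex \<Rightarrow> complex \<Rightarrow> complex \<Rightarrow> (complex \<Rightarrow> complex) \<Rightarrow> complex \<Rightarrow> complex"
where
  "step_op k e j sv se sf r u =
     step_factor k e j u * deriv r u
     + (sv * (1 - 5 * u) * u ^ (k - 1) * (1 - u) powi (4 * int k - 4) * p_e u ^ e * p_f u powi j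
        + 4 * u ^ k * (1 - u) powi (4 * int k - 3)
          * (se * p_e' u * p_e u ^ (e - 1) * p_f u powi j + sf * p_f' u * p_e u ^ e * p_f u powi (j - 1))) * r u"

lemma step_op_dlog:
  assumes u: "u \<noteq> 0" "1 - u \<noteq> 0" "p_e u \<noteq> 0" "p_f u \<noteq> 0" and k: "k = 0 \<longrightarrow> sv = 0" and e: "e = 0 \<longrightarrow> se = 0"
  shows "step_op k e j sv se sf r u = step_factor k e j u * (deriv r u + dlog sv se sf u * r u)"
proof -
  define v a b y where defs: "v = 1 - u" "a = v powi (4 * int k - 4)" "b = p_f u powi (j - 1)" "y = p_e u"
  have a: "v powi (4 * int k - 3) = a * v"
    using power_int_add_1[of v "4 * int k - 4"] u(2) by (simp add: defs)
  have b: "p_f u powi j = b * p_f u"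
    using power_int_add_1[of "p_f u" "j - 1"] u(4) by (simp add: defs)
  have l: "1 / u - 4 / v = (1 - 5 * u) / (u * v)"
    using u by (simp add: defs(1) divide_simps)
  have se: "se * p_e' u * y ^ (e - 1) = y ^ e * (se * (p_e' u / y))"
    using u e by (cases e) (simp_all add: defs(4))
  have sf: "b = b * p_f u / p_f u" using u by simp
  define x where "x = 1 / u - 4 / v"
  have "sv * (1 - 5 * u) * u ^ (k - 1) * a = a * v * u ^ k * sv * x"
    using u k unfolding l x_def by (cases k) (simp_all add: defs(1))
  hence "sv * (1 - 5 * u) * u ^ (k - 1) * a * y ^ e * (b * p_f u)
      = 4 * u ^ k * (a * v) * y ^ e * (b * p_f u) * (sv / 4 * x)"
    by (auto simp: mult_ac)
  moreover have "se * p_e' u * y ^ (e - 1) * (b * p_f u) = y ^ e * (b * p_f u) * (se * (p_e' u / y))"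
    unfolding se by (simp only: mult_ac)
  moreover have "sf * p_f' u * y ^ e * b = y ^ e * (b * p_f u) * (sf * (p_f' u / p_f u))"
    using u by simp
  ultimately show ?thesis
    unfolding step_op_def step_factor_def dlog_def defs(1)[symmetric] defs(2)[symmetric] defs(3)[symmetric]
      defs(4)[symmetric] a b x_def[symmetric]
    by (simp only: ring_distribs mult_ac add_ac)
qed

lemma regular_rational_step_op:
  assumes "regular_rational r"
  shows "regular_rational (step_op k e j sv se sf r)"
  unfolding step_op_def [abs_def] step_factor_def p_e_def p_e'_def p_f'_def
  by (intro regular_rational_intros regular_rational_pow_factors regular_rational_deriv assms)

text \<open>Both coefficients of the equation have at most a simple pole at the origin, so
  multiplication by \<open>u\<close> already makes them holomorphic there.\<close>

definition p_ind :: "complex \<Rightarrow> complex \<Rightarrow> complex \<Rightarrow> complex" where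
  "p_ind N M u = P_num N M u / ((1 - u) * p_f u)"

definition q_ind :: "complex \<Rightarrow> complex \<Rightarrow> complex \<Rightarrow> complex" where
  "q_ind N M u = Q_num N M u / ((1 - u) * p_f u)"

lemma ind_at_0: "p_ind N M 0 = 3/4 - M" "q_ind N M 0 = - ((1 + 12 * M + 12 * N) * (2 * M - 9 * N) / 4)"
  by (simp_all add: p_ind_def q_ind_def P_num_def Q_num_def p_f_def)

lemma ind_PQ: "u \<in> disc - {0} \<Longrightarrow> u * P_cx N M u = p_ind N M u" "u \<in> disc - {0} \<Longrightarrow> u * Q_cx N M u = q_ind N M u"
  using disc_nonzero[of u] by (simp_all add: fractions p_ind_def q_ind_def)

lemma ind_holo: "p_ind N M holomorphic_on disc" "q_ind N M holomorphic_on disc"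
  unfolding p_ind_def [abs_def] q_ind_def [abs_def] P_num_def Q_num_def p_f'_def using disc_nonzero
  by (auto simp: p_f_def intro!: holomorphic_intros)

section \<open>Solutions at the origin\<close>

lemma limit_zero:
  fixes E :: "complex \<Rightarrow> complex"
  assumes "isCont E a" "eventually (\<lambda>u. E u = 0) (at a)"
  shows "E a = 0"
proof -
  have "(E \<longlongrightarrow> 0) (at a)" using assms(2) by (rule tendsto_eventually)
  thus ?thesis using assms(1) by (metis LIM_unique isCont_def)
qed

lemma isCont_holo: "f holomorphic_on S \<Longrightarrow> open S \<Longrightarrow> a \<in> S \<Longrightarrow> isCont f a"
  by (metis continuous_on_eq_continuous_at holomorphic_on_imp_continuous_on)

text \<open>This is the equation multiplied by \<open>u\<close> and evaluated at 0. It supplies the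
  derivative that enters \<open>K\<close> for the steps lowering \<open>m\<close>.\<close>

lemma sol_disc_deriv_0:
  assumes "sol_disc N M r"
  shows "(3/4 - M) * deriv r 0 = (1 + 12 * M + 12 * N) * (2 * M - 9 * N) / 4 * r 0"
proof -
  define E where "E = (\<lambda>u. u * deriv (deriv r) u + p_ind N M u * deriv r u + q_ind N M u * r u)"
  have hol: "r holomorphic_on disc" "deriv r holomorphic_on disc" "deriv (deriv r) holomorphic_on disc"
    using assms unfolding sol_disc_def by (auto intro!: holomorphic_deriv)
  have "E holomorphic_on disc"
    unfolding E_def by (intro holomorphic_intros ind_holo hol)
  hence "isCont E 0" by (rule isCont_holo) auto
  moreover have "E u = 0" if "u \<in> disc - {0}" for u
  proof -
    have "E u = u * (deriv (deriv r) u + P_cx N M u * deriv r u + Q_cx N M u * r u)"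
      unfolding E_def ind_PQ[OF that, symmetric] by (simp add: algebra_simps)
    thus ?thesis using assms that unfolding sol_disc_def by simp
  qed
  hence "eventually (\<lambda>u. E u = 0) (at 0)"
    using eventually_at_in_open[OF open_disc zero_in_disc] by (auto elim: eventually_mono)
  ultimately have "E 0 = 0" by (rule limit_zero)
  hence "(3/4 - M) * deriv r 0 - (1 + 12 * M + 12 * N) * (2 * M - 9 * N) / 4 * r 0 = 0"
    by (simp add: E_def ind_at_0)
  thus ?thesis by (simp only: right_minus_eq)
qed

text \<open>
  A nonzero difference of two solutions would vanish at 0 to an order \<open>k > 0\<close> that is a root of the
  indicial polynomial, but the only other root \<open>1/4 + m\<close> is not an integer.
\<close>

lemma frobenius_unique_0:
  assumes an: "y1 analytic_on {0}" "y2 analytic_on {0}" and eq0: "y1 0 = y2 0"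
    and ode: "\<forall>\<^sub>F u in at 0. deriv (deriv y1) u + P_cx N (of_int m) u * deriv y1 u + Q_cx N (of_int m) u * y1 u = 0"
      "\<forall>\<^sub>F u in at 0. deriv (deriv y2) u + P_cx N (of_int m) u * deriv y2 u + Q_cx N (of_int m) u * y2 u = 0"
  shows "\<forall>\<^sub>F u in nhds 0. y1 u = y2 u"
proof -
  define M :: complex where "M = of_int m"
  obtain S1 S2 where S: "open S1" "0 \<in> S1" "y1 holomorphic_on S1" "open S2" "0 \<in> S2" "y2 holomorphic_on S2"
    using an by (auto simp: analytic_at)
  define O1 where "O1 = {u. deriv (deriv y1) u + P_cx N M u * deriv y1 u + Q_cx N M u * y1 u = 0 \<and>
      deriv (deriv y2) u + P_cx N M u * deriv y2 u + Q_cx N M u * y2 u = 0}"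
  have "\<forall>\<^sub>F u in at 0. u \<in> S1 \<inter> S2 \<inter> disc \<and> u \<in> O1"
  proof (rule eventually_conj)
    show "\<forall>\<^sub>F u in at 0. u \<in> S1 \<inter> S2 \<inter> disc"
      using S by (intro eventually_at_in_open') auto
    show "\<forall>\<^sub>F u in at 0. u \<in> O1"
      using ode by eventually_elim (simp add: O1_def M_def)
  qed
  then obtain d where d: "d > 0" "\<And>u. u \<noteq> 0 \<Longrightarrow> dist u 0 < d \<Longrightarrow> u \<in> S1 \<inter> S2 \<inter> disc \<and> u \<in> O1"
    unfolding eventually_at by blast
  define D where "D = ball (0::complex) d"
  have D: "open D" "0 \<in> D" "connected D" using d by (auto simp: D_def)
  have sub: "D \<subseteq> S1 \<inter> S2 \<inter> disc"
    using d(2) S by (metis D_def Int_iff dist_commute mem_ball subsetI zero_in_disc)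
  have inO: "u \<in> O1" if "u \<in> D" "u \<noteq> 0" for u
    using d(2)[of u] that by (auto simp: D_def dist_commute)
  have y: "y1 holomorphic_on D" "y2 holomorphic_on D"
    using S sub by (auto intro: holomorphic_on_subset)
  define f where "f = (\<lambda>u. y1 u - y2 u)"
  have f: "f holomorphic_on D" unfolding f_def by (intro holomorphic_intros y)
  have df: "deriv f u = deriv y1 u - deriv y2 u" if "u \<in> D" for u
    unfolding f_def using y that D by (intro deriv_diff holomorphic_on_imp_differentiable_at) auto
  have ddf: "deriv (deriv f) u = deriv (deriv y1) u - deriv (deriv y2) u" if "u \<in> D" for u
  proof -
    have "deriv (deriv f) u = deriv (\<lambda>u. deriv y1 u - deriv y2 u) u"
      using eventually_nhds_in_open[OF D(1) that] by (intro deriv_cong_ev refl) (auto elim!: eventually_mono simp: df)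
    also have "\<dots> = deriv (deriv y1) u - deriv (deriv y2) u"
      using holomorphic_deriv[OF y(1) D(1)] holomorphic_deriv[OF y(2) D(1)] that D
      by (intro deriv_diff holomorphic_on_imp_differentiable_at) auto
    finally show ?thesis .
  qed
  have fode: "u * deriv (deriv f) u + p_ind N M u * deriv f u + q_ind N M u * f u = 0" if "u \<in> D" "u \<noteq> 0" for u
  proof -
    have "u \<in> disc - {0}" using sub that by auto
    hence "u * deriv (deriv f) u + p_ind N M u * deriv f u + q_ind N M u * f u
      = u * ((deriv (deriv y1) u + P_cx N M u * deriv y1 u + Q_cx N M u * y1 u) -
          (deriv (deriv y2) u + P_cx N M u * deriv y2 u + Q_cx N M u * y2 u))"
      unfolding ddf[OF that(1)] df[OF that(1)] by (simp add: f_def ind_PQ[symmetric] algebra_simps)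
    thus ?thesis using inO[OF that] by (simp add: O1_def)
  qed
  have "f u = 0" if "u \<in> D" for u
  proof (rule ccontr)
    assume "f u \<noteq> 0"
    define k where "k = nat (zorder f 0)"
    define h where "h = zor_poly f 0"
    have "(if f 0 = 0 then zorder f 0 > 0 else zorder f 0 = 0) \<and>
      (\<exists>r>0. cball 0 r \<subseteq> D \<and> h holomorphic_on cball 0 r \<and> (\<forall>w\<in>cball 0 r. f w = h w * (w - 0) ^ k \<and> h w \<noteq> 0))"
      unfolding h_def k_def using \<open>f u \<noteq> 0\<close> that by (intro zorder_exist_zero[OF f D(1,3,2)]) auto
    moreover have "f 0 = 0" using eq0 by (simp add: f_def)
    ultimately obtain r where r: "k > 0" "r > 0" "cball 0 r \<subseteq> D" "h holomorphic_on cball 0 r"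
        "\<And>w. w \<in> cball 0 r \<Longrightarrow> f w = h w * w ^ k \<and> h w \<noteq> 0"
      by (auto simp: k_def)
    define B where "B = ball (0::complex) r"
    have "B \<subseteq> D" using order_trans[OF ball_subset_cball r(3)] by (simp add: B_def)
    hence B: "open B" "0 \<in> B" "B \<subseteq> D" "B \<subseteq> disc" using r(2) sub by (auto simp: B_def)
    have h: "h holomorphic_on B" "deriv h holomorphic_on B" "deriv (deriv h) holomorphic_on B"
      using r(4) B(1) by (auto simp: B_def intro!: holomorphic_deriv intro: holomorphic_on_subset)
    have hD: "(h has_field_derivative deriv h w) (at w)"
      "(deriv h has_field_derivative deriv (deriv h) w) (at w)" if "w \<in> B" for w
      using h that B(1) by (metis holomorphic_derivI)+
    \<comment> \<open>The derivatives of \<open>w ^ k * h w\<close> are written with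
      \<open>l = k - 1\<close> so that the factor \<open>w ^ l\<close> can be split off from the
      whole equation.\<close>
    define l where "l = k - 1"
    have k: "k = Suc l" using r(1) by (simp add: l_def)
    have fB: "f w = w ^ k * h w" if "w \<in> B" for w using r(5)[of w] that by (auto simp: B_def)
    have f1: "deriv f w = w ^ l * (of_nat k * h w + w * deriv h w)" if w: "w \<in> B" for w
    proof -
      have "((\<lambda>w. w ^ k * h w) has_field_derivative w ^ l * (of_nat k * h w + w * deriv h w)) (at w)"
        unfolding k by (rule derivative_eq_intros DERIV_power hD w refl | simp add: algebra_simps)+
      from has_field_derivative_transform_within_open[OF this B(1) w, where g = f]
      show ?thesis using fB by (intro DERIV_imp_deriv) auto
    qed
    have f2: "w * deriv (deriv f) w = w ^ l * (of_nat l * (of_nat k * h w + w * deriv h w)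
        + w * (of_nat k * deriv h w + deriv h w + w * deriv (deriv h) w))" if w: "w \<in> B" for w
    proof -
      have "((\<lambda>w. w ^ l * (of_nat k * h w + w * deriv h w)) has_field_derivative
        (of_nat l * w ^ (l - 1)) * (of_nat k * h w + w * deriv h w)
        + w ^ l * (of_nat k * deriv h w + deriv h w + w * deriv (deriv h) w)) (at w)"
        by (rule derivative_eq_intros DERIV_power hD w refl | simp add: algebra_simps)+
      from has_field_derivative_transform_within_open[OF this B(1) w, where g = "deriv f"]
      have "deriv (deriv f) w = (of_nat l * w ^ (l - 1)) * (of_nat k * h w + w * deriv h w)
        + w ^ l * (of_nat k * deriv h w + deriv h w + w * deriv (deriv h) w)"
        using f1 by (intro DERIV_imp_deriv) auto
      moreover have "w * (of_nat l * w ^ (l - 1)) = of_nat l * w ^ l" by (cases l) auto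
      moreover have "w * (A * x + B * y) = (w * A) * x + w * (B * y)" for A B x y
        by (simp add: algebra_simps)
      ultimately have "w * deriv (deriv f) w = of_nat l * w ^ l * (of_nat k * h w + w * deriv h w)
        + w * (w ^ l * (of_nat k * deriv h w + deriv h w + w * deriv (deriv h) w))"
        by (simp only:)
      thus ?thesis by (simp add: algebra_simps)
    qed
    \<comment> \<open>The equation for \<open>f\<close>, multiplied by \<open>w\<close> and divided
      by \<open>w ^ l\<close>; its value at 0 is the indicial polynomial at \<open>k\<close> times
      \<open>h 0\<close>.\<close>
    define E where "E = (\<lambda>w. of_nat l * (of_nat k * h w + w * deriv h w)
        + w * (of_nat k * deriv h w + deriv h w + w * deriv (deriv h) w)
        + p_ind N M w * (of_nat k * h w + w * deriv h w) + q_ind N M w * (w * h w))"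
    have "p_ind N M holomorphic_on B" "q_ind N M holomorphic_on B"
      by (rule holomorphic_on_subset[OF _ B(4)], rule ind_holo)+
    hence "E holomorphic_on B"
      unfolding E_def by (intro holomorphic_intros h)
    hence "isCont E 0" using B by (intro isCont_holo) auto
    moreover have "E w = 0" if w: "w \<in> B" "w \<noteq> 0" for w
    proof -
      have "w ^ l * E w = w * deriv (deriv f) w + p_ind N M w * deriv f w + q_ind N M w * f w"
        unfolding f2[OF w(1)] f1[OF w(1)] fB[OF w(1)] E_def k by (simp add: algebra_simps)
      also have "\<dots> = 0" using fode w B(3) by blast
      finally show ?thesis using w by simp
    qed
    hence "eventually (\<lambda>u. E u = 0) (at 0)"
      using eventually_at_in_open[OF B(1,2)] by (auto elim: eventually_mono)
    ultimately have "E 0 = 0" by (rule limit_zero)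
    hence "(of_nat l + 3/4 - M) * (of_nat k * h 0) = 0"
      by (simp add: E_def ind_at_0 algebra_simps)
    moreover have "h 0 \<noteq> 0" using r by auto
    moreover have "of_nat k \<noteq> (0 :: complex)" using r(1) by simp
    ultimately have "of_nat l + 3/4 - M = 0" by (simp only: mult_eq_0_iff) blast
    hence "4 * of_nat l + 3 = (4 * M :: complex)" by (simp add: field_simps)
    \<comment> \<open>The exponent \<open>1/4 + m\<close> would have to equal \<open>l + 1\<close>;
      residues modulo 4 exclude this.\<close>
    hence "(of_int (4 * int l + 3) :: complex) = of_int (4 * m)" by (simp add: M_def)
    hence "4 * int l + 3 = 4 * m" by (simp only: of_int_eq_iff)
    thus False by presburger
  qed
  hence "y1 u = y2 u" if "u \<in> D" for u using that by (simp add: f_def)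
  thus ?thesis using eventually_nhds_in_open[OF D(1,2)] by (auto elim: eventually_mono)
qed

section \<open>The hypergeometric equation and its pullback\<close>

lemma fps_hypergeo_2_1_rec:
  fixes a b c :: complex
  shows "fps_hypergeo [a, b] [c] 1 $ Suc k
    = (a + of_nat k) * (b + of_nat k) / ((1 + of_nat k) * (c + of_nat k)) * fps_hypergeo [a, b] [c] 1 $ k"
  by (subst fps_hypergeo_rec) (simp add: mult_ac add_ac)

lemma one_plus_of_nat_nonzero: "1 + of_nat k \<noteq> (0 :: complex)"
  by (metis of_nat_Suc of_nat_neq_0)

text \<open>Ratio test: the assumptions on \<open>a\<close> and \<open>b\<close> keep all
  coefficients nonzero, and dividing every factor by \<open>1 + k\<close> gives quotients that tend
  to 1.\<close>

lemma fps_conv_radius_hypergeo: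
  fixes a b c :: complex
  assumes "\<And>k. a \<noteq> - of_nat k" "\<And>k. b \<noteq> - of_nat k" "\<And>k. c \<noteq> - of_nat k"
  shows "fps_conv_radius (fps_hypergeo [a, b] [c] 1) = 1"
proof -
  define f where "f = fps_nth (fps_hypergeo [a, b] [c] 1)"
  have nz: "a + of_nat k \<noteq> 0" "b + of_nat k \<noteq> 0" "c + of_nat k \<noteq> 0" for k
    using assms[of k] by (auto simp: add_eq_0_iff2)
  have rec: "f (Suc k) = (a + of_nat k) * (b + of_nat k) / ((1 + of_nat k) * (c + of_nat k)) * f k" for k
    unfolding f_def by (rule fps_hypergeo_2_1_rec)
  have fnz: "f k \<noteq> 0" for k
  proof (induction k)
    case 0
    show ?case by (simp add: f_def)
  next
    case (Suc k)
    thus ?case using nz[of k] one_plus_of_nat_nonzero[of k] by (simp add: rec)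
  qed
  have inv: "(\<lambda>k. inverse (of_nat (Suc k)) :: complex) \<longlonglongrightarrow> 0"
    using LIMSEQ_inverse_real_of_nat tendsto_of_real[OF LIMSEQ_inverse_real_of_nat, where 'a = complex] by simp
  have lim1: "(\<lambda>k. (x + of_nat k) / (1 + of_nat k)) \<longlonglongrightarrow> 1" for x :: complex
  proof -
    have "(\<lambda>k. (x - 1) * inverse (of_nat (Suc k)) + 1) \<longlonglongrightarrow> (x - 1) * 0 + 1"
      by (intro tendsto_intros inv)
    also have "(\<lambda>k. (x - 1) * inverse (of_nat (Suc k)) + 1) = (\<lambda>k. (x + of_nat k) / (1 + of_nat k))"
    proof
      fix k
      have "1 + of_nat k \<noteq> (0 :: complex)" by (rule one_plus_of_nat_nonzero)
      thus "(x - 1) * inverse (of_nat (Suc k)) + 1 = (x + of_nat k) / (1 + of_nat k)"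
        by (simp add: field_simps)
    qed
    finally show ?thesis by simp
  qed
  have "(\<lambda>k. (1 * ((c + of_nat k) / (1 + of_nat k))) / (((a + of_nat k) / (1 + of_nat k)) * ((b + of_nat k) / (1 + of_nat k)))) \<longlonglongrightarrow> (1 * 1) / (1 * 1)"
    by (intro tendsto_intros lim1) auto
  also have "(\<lambda>k. (1 * ((c + of_nat k) / (1 + of_nat k))) / (((a + of_nat k) / (1 + of_nat k)) * ((b + of_nat k) / (1 + of_nat k))))
     = (\<lambda>k. f k / f (Suc k))"
  proof
    fix k
    have "1 + of_nat k \<noteq> (0 :: complex)" by (rule one_plus_of_nat_nonzero)
    thus "(1 * ((c + of_nat k) / (1 + of_nat k))) / (((a + of_nat k) / (1 + of_nat k)) * ((b + of_nat k) / (1 + of_nat k)))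
      = f k / f (Suc k)"
      using nz[of k] fnz[of k] unfolding rec by (simp add: divide_simps)
  qed
  finally have "(\<lambda>k. norm (f k / f (Suc k))) \<longlonglongrightarrow> norm (1 :: complex)"
    by (intro tendsto_norm) simp
  hence "conv_radius f = ereal 1"
    by (intro conv_radius_ratio_limit_nonzero) (auto simp: norm_divide)
  thus ?thesis by (simp add: fps_conv_radius_def f_def one_ereal_def)
qed

text \<open>Comparing coefficients turns the equation into the two-term recursion of the
  hypergeometric coefficients.\<close>

lemma fps_hypergeo_ode:
  fixes a b c :: complex
  assumes "\<And>k. c \<noteq> - of_nat k"
  defines "F \<equiv> fps_hypergeo [a, b] [c] 1"
  shows "fps_X * (1 - fps_X) * fps_deriv (fps_deriv F)
     + (fps_const c - fps_const (a + b + 1) * fps_X) * fps_deriv F - fps_const (a * b) * F = 0"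
proof (rule fps_ext)
  fix n
  have nz: "c + of_nat k \<noteq> 0" for k
    using assms(1)[of k] by (auto simp: add_eq_0_iff2)
  have rec: "(1 + of_nat k) * (c + of_nat k) * F $ Suc k = (a + of_nat k) * (b + of_nat k) * F $ k" for k
  proof -
    have "1 + of_nat k \<noteq> (0 :: complex)" by (rule one_plus_of_nat_nonzero)
    thus ?thesis
      using nz[of k] fps_hypergeo_2_1_rec[of a b c k, folded F_def] by simp
  qed
  have "fps_X * (1 - fps_X) * fps_deriv (fps_deriv F)
     + (fps_const c - fps_const (a + b + 1) * fps_X) * fps_deriv F - fps_const (a * b) * F
    = fps_X * fps_deriv (fps_deriv F) - fps_X * (fps_X * fps_deriv (fps_deriv F))
     + (fps_const c * fps_deriv F - fps_const (a + b + 1) * (fps_X * fps_deriv F)) - fps_const (a * b) * F"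
    by (simp only: ring_distribs mult_1_right mult_1_left mult.assoc)
  also have "\<dots> $ n = (1 + of_nat n) * (c + of_nat n) * F $ Suc n - (a + of_nat n) * (b + of_nat n) * F $ n"
  proof (cases n)
    case 0
    thus ?thesis by simp
  next
    case (Suc l)
    show ?thesis unfolding Suc by (cases l) (simp_all add: algebra_simps)
  qed
  also have "\<dots> = 0" by (simp add: rec)
  finally show "(fps_X * (1 - fps_X) * fps_deriv (fps_deriv F)
     + (fps_const c - fps_const (a + b + 1) * fps_X) * fps_deriv F - fps_const (a * b) * F) $ n = 0 $ n"
    by simp
qed

lemma less_fps_conv_radius:
  fixes f g :: "complex fps"
  assumes "x < fps_conv_radius f" "x < fps_conv_radius g"
  shows "x < fps_conv_radius (f + g)" "x < fps_conv_radius (f * g)"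
  using less_le_trans[OF _ fps_conv_radius_add, of x f g] less_le_trans[OF _ fps_conv_radius_mult, of x f g] assms
  by auto

lemma hyp2F1_ode:
  fixes a b c :: complex
  assumes nz: "\<And>k. a \<noteq> - of_nat k" "\<And>k. b \<noteq> - of_nat k" "\<And>k. c \<noteq> - of_nat k"
  obtains F1 F2 where
    "\<And>z. norm z < 1 \<Longrightarrow> (hyp2F1 a b c has_field_derivative F1 z) (at z)"
    "\<And>z. norm z < 1 \<Longrightarrow> (F1 has_field_derivative F2 z) (at z)"
    "\<And>z. norm z < 1 \<Longrightarrow> z * (1 - z) * F2 z + (c - (a + b + 1) * z) * F1 z - a * b * hyp2F1 a b c z = 0"
proof
  define F where "F = fps_hypergeo [a, b] [c] 1"
  have r0: "fps_conv_radius F = 1" unfolding F_def by (rule fps_conv_radius_hypergeo[OF nz])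
  have r1: "fps_conv_radius (fps_deriv F) \<ge> 1" using fps_conv_radius_deriv[of F] r0 by simp
  have r2: "fps_conv_radius (fps_deriv (fps_deriv F)) \<ge> 1"
    using fps_conv_radius_deriv[of "fps_deriv F"] r1 by (rule order_trans[rotated])
  fix z :: complex assume z: "norm z < 1"
  have z0: "ereal (norm z) < fps_conv_radius F" using z r0 by (simp add: one_ereal_def)
  have z1: "ereal (norm z) < fps_conv_radius (fps_deriv F)"
    using z r1 by (metis ereal_less(3) less_ereal.simps(1) one_ereal_def order_less_le_trans)
  have z2: "ereal (norm z) < fps_conv_radius (fps_deriv (fps_deriv F))"
    using z r2 by (metis ereal_less(3) less_ereal.simps(1) one_ereal_def order_less_le_trans)
  have hyp: "hyp2F1 a b c = eval_fps F" by (simp add: fun_eq_iff hyp2F1_def F_def)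
  show "(hyp2F1 a b c has_field_derivative eval_fps (fps_deriv F) z) (at z)"
    unfolding hyp by (rule has_field_derivative_eval_fps[OF z0])
  show "(eval_fps (fps_deriv F) has_field_derivative eval_fps (fps_deriv (fps_deriv F)) z) (at z)"
    by (rule has_field_derivative_eval_fps[OF z1])
  define G where "G = fps_X * (1 - fps_X) * fps_deriv (fps_deriv F)
     + (fps_const c - fps_const (a + b + 1) * fps_X) * fps_deriv F - fps_const (a * b) * F"
  have G0: "G = 0" unfolding G_def F_def by (rule fps_hypergeo_ode[OF nz(3)])
  \<comment> \<open>The polynomial coefficients converge everywhere, so evaluation commutes with the
    products in \<open>G\<close> wherever the derivatives of \<open>F\<close> converge.\<close>
  have inf: "fps_conv_radius (fps_X * (1 - fps_X) :: complex fps) = \<infinity>"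
     "fps_conv_radius (1 - fps_X :: complex fps) = \<infinity>"
    "fps_conv_radius (fps_const c - fps_const (a + b + 1) * fps_X) = \<infinity>"
    "fps_conv_radius (fps_const (a + b + 1) * fps_X) = \<infinity>"
  proof -
    have "fps_of_poly [:0, 1, -1:] = (fps_X * (1 - fps_X) :: complex fps)"
      by (simp add: fps_of_poly_pCons algebra_simps)
    thus "fps_conv_radius (fps_X * (1 - fps_X) :: complex fps) = \<infinity>" by (metis fps_conv_radius_fps_of_poly)
    have "fps_of_poly [:1, -1:] = (1 - fps_X :: complex fps)"
      by (simp add: fps_of_poly_pCons algebra_simps)
    thus "fps_conv_radius (1 - fps_X :: complex fps) = \<infinity>" by (metis fps_conv_radius_fps_of_poly)
    have "fps_of_poly [:c, -(a + b + 1):] = fps_const c - fps_const (a + b + 1) * fps_X"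
      by (simp add: fps_of_poly_pCons algebra_simps flip: fps_const_neg fps_const_add)
    thus "fps_conv_radius (fps_const c - fps_const (a + b + 1) * fps_X) = \<infinity>" by (metis fps_conv_radius_fps_of_poly)
    have "fps_of_poly [:0, a + b + 1:] = fps_const (a + b + 1) * fps_X"
      by (simp add: fps_of_poly_pCons algebra_simps flip: fps_const_neg fps_const_add)
    thus "fps_conv_radius (fps_const (a + b + 1) * fps_X) = \<infinity>" by (metis fps_conv_radius_fps_of_poly)
  qed
  have m1: "ereal (norm z) < fps_conv_radius (fps_X * (1 - fps_X) * fps_deriv (fps_deriv F))"
    by (rule less_fps_conv_radius(2)[OF _ z2]) (simp only: inf, simp)
  have m2: "ereal (norm z) < fps_conv_radius ((fps_const c - fps_const (a + b + 1) * fps_X) * fps_deriv F)"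
    by (rule less_fps_conv_radius(2)[OF _ z1]) (simp only: inf, simp)
  have m3: "ereal (norm z) < fps_conv_radius (fps_const (a * b) * F)"
    by (rule less_fps_conv_radius(2)[OF _ z0]) simp
  note m12 = less_fps_conv_radius(1)[OF m1 m2]
  have "0 = eval_fps G z" by (simp add: G0)
  also have "\<dots> = z * (1 - z) * eval_fps (fps_deriv (fps_deriv F)) z
     + (c - (a + b + 1) * z) * eval_fps (fps_deriv F) z - a * b * eval_fps F z"
    unfolding G_def using m1 m2 m3 m12 z0 z1 z2
    by (simp add: eval_fps_diff eval_fps_add eval_fps_mult inf del: fps_const_add fps_const_mult)
  finally show "z * (1 - z) * eval_fps (fps_deriv (fps_deriv F)) z
     + (c - (a + b + 1) * z) * eval_fps (fps_deriv F) z - a * b * hyp2F1 a b c z = 0"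
    by (simp add: hyp)
qed

lemma hyp2F1_0 [simp]: "hyp2F1 a b c 0 = 1"
  by (simp add: hyp2F1_def eval_fps_at_0)

section \<open>Pullback of the hypergeometric equation along \<open>R_oct\<close>\<close>

text \<open>The factored derivative displays the ramification: index 4 at \<open>u = 1\<close>, 3 at
  the zeros of \<open>p_f\<close>, 2 at the zeros of \<open>p_e\<close>.\<close>

definition R_oct' :: "complex \<Rightarrow> complex" where
  "R_oct' u = - 108 * (1 - u) ^ 3 * p_f u ^ 2 / p_e u ^ 3"

lemma R_oct_deriv:
  assumes "p_e u \<noteq> 0"
  shows "(R_oct has_field_derivative R_oct' u) (at u)"
proof -
  have 1: "((\<lambda>u. - 108 * (u * (1 - u) ^ 4)) has_field_derivative - 108 * ((1 - u) ^ 3 * (1 - 5 * u))) (at u)"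
    by (auto intro!: derivative_eq_intros) algebra
  have 2: "((\<lambda>u. p_e u ^ 2) has_field_derivative 2 * p_e u * p_e' u) (at u)"
    by (auto intro!: derivative_eq_intros chain_derivs)
  have "((\<lambda>u. - 108 * (u * (1 - u) ^ 4) / p_e u ^ 2) has_field_derivative
      ((- 108 * ((1 - u) ^ 3 * (1 - 5 * u))) * p_e u ^ 2 - (- 108 * (u * (1 - u) ^ 4)) * (2 * p_e u * p_e' u))
         / (p_e u ^ 2 * p_e u ^ 2)) (at u)"
    using assms by (intro DERIV_divide[OF 1 2]) simp
  also have "((- 108 * ((1 - u) ^ 3 * (1 - 5 * u))) * p_e u ^ 2 - (- 108 * (u * (1 - u) ^ 4)) * (2 * p_e u * p_e' u))
      = - 108 * (1 - u) ^ 3 * p_f u ^ 2 * p_e u"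
    unfolding p_e_def p_e'_def p_f_def by algebra
  also have "\<dots> / (p_e u ^ 2 * p_e u ^ 2) = R_oct' u"
    using assms by (simp add: R_oct'_def eval_nat_numeral)
  finally show ?thesis unfolding R_oct_def [abs_def] p_v_def .
qed

lemma R_oct'_deriv:
  assumes "1 - u \<noteq> 0" "p_e u \<noteq> 0" "p_f u \<noteq> 0"
  shows "(R_oct' has_field_derivative
    R_oct' u * (- 3 / (1 - u) + 2 * (p_f' u / p_f u) - 3 * (p_e' u / p_e u))) (at u)"
proof -
  have 0: "((\<lambda>u. - 108) has_field_derivative (- 108) * 0) (at u)" by simp
  have 1: "((\<lambda>u. (1 - u) ^ 3) has_field_derivative (1 - u) ^ 3 * (- 3 / (1 - u))) (at u)"
    using assms by (auto intro!: derivative_eq_intros simp: eval_nat_numeral) (simp add: algebra_simps)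
  have 2: "((\<lambda>u. p_f u ^ 2) has_field_derivative p_f u ^ 2 * (2 * (p_f' u / p_f u))) (at u)"
    using assms by (auto intro!: derivative_eq_intros chain_derivs simp: eval_nat_numeral)
  have 3: "((\<lambda>u. inverse (p_e u ^ 3)) has_field_derivative inverse (p_e u ^ 3) * (- (3 * (p_e' u / p_e u)))) (at u)"
    using assms by (auto intro!: derivative_eq_intros chain_derivs simp: eval_nat_numeral field_simps)
  have "((\<lambda>u. - 108 * (1 - u) ^ 3 * p_f u ^ 2 * inverse (p_e u ^ 3)) has_field_derivative
      - 108 * (1 - u) ^ 3 * p_f u ^ 2 * inverse (p_e u ^ 3)
        * (0 + (- 3 / (1 - u)) + 2 * (p_f' u / p_f u) + (- (3 * (p_e' u / p_e u))))) (at u)"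
    by (intro log_deriv_mult 0 1 2 3)
  thus ?thesis by (simp add: R_oct'_def [abs_def] divide_inverse)
qed

text \<open>For \<open>y = p_e^al * F(R)\<close> the expression \<open>y'' + P y' + Q y\<close> is
  \<open>p_e^al\<close> times a combination of \<open>F\<close>, \<open>F'\<close>,
  \<open>F''\<close> at \<open>R\<close>. This lemma and the next two show that its three
  coefficients are those of the hypergeometric equation times the common factor
  \<open>R' * p_e / (u * (1 - u) * p_f)\<close>. Here the coefficient of \<open>F\<close> is
  treated; \<open>- al / 2\<close> and \<open>1/2 - al / 2\<close> are the upper parameters.\<close>

lemma pullback_coeff_0:
  assumes u: "u \<noteq> 0" "1 - u \<noteq> 0" "p_e u \<noteq> 0" "p_f u \<noteq> 0"
    and al: "al = 1/12 + M + N"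
  shows "dlog 0 al 0 u ^ 2 + ddlog 0 al 0 u + P_cx N M u * dlog 0 al 0 u + Q_cx N M u
    = - (R_oct' u * (p_e u / (u * (1 - u) * p_f u)) * ((- al / 2) * (1/2 - al / 2)))"
proof -
  define x where "x = u * (1 - u) * p_f u"
  have x: "x \<noteq> 0" using u by (simp add: x_def)
  have xe: "u * (1 - u) * p_e u * p_f u = x * p_e u" by (simp add: x_def)
  have ab: "27 * u * (1 - u) ^ 4 * p_f u ^ 3 * al * (al - 1)
     = 108 * (u * (1 - u) ^ 4 * p_f u ^ 3) * ((- al / 2) * (1/2 - al / 2))"
    by (simp add: field_simps)
  have N: "N = al - 1/12 - M" by (simp add: al)
  have id: "dlog_num 0 al 0 u ^ 2 + ddlog_num 0 al 0 u + P_num N M u * dlog_num 0 al 0 u * p_e u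
     + Q_num N M u * (u * (1 - u) * p_f u) * p_e u ^ 2
     = 27 * u * (1 - u) ^ 4 * p_f u ^ 3 * al * (al - 1)"
    unfolding N dlog_num_def ddlog_num_def P_num_def Q_num_def p_e_def p_e'_def p_f_def p_f'_def by algebra
  have r: "R_oct' u * (p_e u / x) = - 108 * (u * (1 - u) ^ 4 * p_f u ^ 3) / (x ^ 2 * p_e u ^ 2)"
    using u by (simp add: R_oct'_def x_def eval_nat_numeral)
  have "dlog 0 al 0 u ^ 2 + ddlog 0 al 0 u + P_cx N M u * dlog 0 al 0 u + Q_cx N M u
    = (dlog_num 0 al 0 u ^ 2 + ddlog_num 0 al 0 u + P_num N M u * dlog_num 0 al 0 u * p_e u
     + Q_num N M u * x * p_e u ^ 2) / (x ^ 2 * p_e u ^ 2)"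
    unfolding fractions[OF u] xe x_def[symmetric] using x u(3)
    by (simp add: add_divide_distrib power_mult_distrib power_divide) (simp add: power2_eq_square)
  also have "\<dots> = - (R_oct' u * (p_e u / x) * ((- al / 2) * (1/2 - al / 2)))"
    unfolding id[folded x_def] r unfolding ab by simp
  finally show ?thesis unfolding x_def .
qed

text \<open>The coefficient of \<open>F'\<close>, after removal of \<open>R'\<close>. The bracketed
  sum is \<open>R'' / R'\<close>, and \<open>3/2 - al\<close> is \<open>a + b + 1\<close>.\<close>

lemma pullback_coeff_1:
  assumes u: "u \<noteq> 0" "1 - u \<noteq> 0" "p_e u \<noteq> 0" "p_f u \<noteq> 0"
    and al: "al = 1/12 + M + N"
  shows "2 * dlog 0 al 0 u + (- 3 / (1 - u) + 2 * (p_f' u / p_f u) - 3 * (p_e' u / p_e u)) + P_cx N M u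
    = (p_e u / (u * (1 - u) * p_f u)) * ((3/4 - M) - (3/2 - al) * R_oct u)"
proof -
  define v where "v = 1 - u"
  have nz: "v \<noteq> 0" using u by (simp add: v_def)
  have id: "2 * al * p_e' u * u * (1 - u) * p_f u - 3 * u * p_e u * p_f u + 2 * p_f' u * u * (1 - u) * p_e u
     - 3 * p_e' u * u * (1 - u) * p_f u + P_num N M u * p_e u
     = (3/4 - M) * p_e u ^ 2 + (3/2 - al) * 108 * (u * (1 - u) ^ 4)"
    unfolding al P_num_def p_e_def p_e'_def p_f_def p_f'_def by algebra
  have "2 * dlog 0 al 0 u + (- 3 / v + 2 * (p_f' u / p_f u) - 3 * (p_e' u / p_e u)) + P_num N M u / (u * v * p_f u)
    = (2 * al * p_e' u * u * v * p_f u - 3 * u * p_e u * p_f u + 2 * p_f' u * u * v * p_e u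
     - 3 * p_e' u * u * v * p_f u + P_num N M u * p_e u) / (u * v * p_e u * p_f u)"
    unfolding dlog_def using u nz by (simp add: add_divide_distrib diff_divide_distrib)
  also have "\<dots> = ((3/4 - M) * p_e u ^ 2 + (3/2 - al) * 108 * (u * v ^ 4)) / (u * v * p_e u * p_f u)"
    unfolding id[folded v_def] ..
  also have "\<dots> = (p_e u / (u * v * p_f u)) * ((3/4 - M) - (3/2 - al) * R_oct u)"
    unfolding R_oct_def p_v_def v_def[symmetric] using u nz by (simp add: field_simps power2_eq_square)
  finally show ?thesis unfolding fractions(3)[OF u] v_def .
qed

text \<open>The coefficient of \<open>F''\<close>. The identity \<open>1 - R = p_f^3 / p_e^2\<close>
  makes both sides monomials in \<open>u\<close>, \<open>1 - u\<close>, \<open>p_e\<close>,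
  \<open>p_f\<close>.\<close>

lemma R_oct'_sq:
  assumes "u \<noteq> 0" "1 - u \<noteq> 0" "p_e u \<noteq> 0" "p_f u \<noteq> 0"
  shows "R_oct' u ^ 2 = R_oct u * (1 - R_oct u) * (R_oct' u * (p_e u / (u * (1 - u) * p_f u)))"
proof -
  have "1 - R_oct u = p_f u ^ 3 / p_e u ^ 2" using R_oct_alt[OF assms(3)] by simp
  thus ?thesis using assms by (simp add: R_oct'_def R_oct_def p_v_def) (simp add: field_simps eval_nat_numeral)
qed

lemma Re_p_e_pos: "u \<in> disc \<Longrightarrow> Re (p_e u) > 0"
  using norm_p_e_minus_1[of u] abs_Re_le_cmod[of "p_e u - 1"] by simp

text \<open>The defining relation of the octahedral function, solved for that function.\<close>

definition hyp_near_0 :: "int \<Rightarrow> int \<Rightarrow> complex \<Rightarrow> complex" where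
  "hyp_near_0 n m u = p_e u powr (1/12 + of_int m + of_int n)
     * hyp2F1 (- 1/24 - of_int m / 2 - of_int n / 2) (11/24 - of_int m / 2 - of_int n / 2)
         (3/4 - of_int m) (R_oct u)"

lemma hyp_near_0:
  shows "hyp_near_0 n m analytic_on {0}" "hyp_near_0 n m 0 = 1"
    "\<forall>\<^sub>F u in at 0. deriv (deriv (hyp_near_0 n m)) u + P_cx (of_int n) (of_int m) u * deriv (hyp_near_0 n m) u
       + Q_cx (of_int n) (of_int m) u * hyp_near_0 n m u = 0"
proof -
  define al :: complex where "al = 1/12 + of_int m + of_int n"
  define a where "a = - al / 2"
  define b where "b = 1/2 - al / 2"
  define c :: complex where "c = 3/4 - of_int m"
  have nz: "a \<noteq> - of_nat k" "b \<noteq> - of_nat k" "c \<noteq> - of_nat k" for k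
  proof -
    \<comment> \<open>Parity separates the first two pairs of integers, residues modulo 4 the third;
      hence the series does not terminate and its coefficients are defined.\<close>
    have 1: "of_int (1 + 12 * m + 12 * n) \<noteq> (of_int (24 * int k) :: complex)"
      unfolding of_int_eq_iff by presburger
    have 2: "of_int (12 - (1 + 12 * m + 12 * n)) \<noteq> (of_int (- 24 * int k) :: complex)"
      unfolding of_int_eq_iff by presburger
    have 3: "of_int (3 - 4 * m) \<noteq> (of_int (- 4 * int k) :: complex)"
      unfolding of_int_eq_iff by presburger
    show "a \<noteq> - of_nat k" using 1 by (auto simp: a_def al_def field_simps)
    show "b \<noteq> - of_nat k" using 2 by (auto simp: b_def al_def field_simps)
    show "c \<noteq> - of_nat k" using 3 by (auto simp: c_def field_simps)
  qed
  obtain F1 F2 where F: 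
    "\<And>z. norm z < 1 \<Longrightarrow> (hyp2F1 a b c has_field_derivative F1 z) (at z)"
    "\<And>z. norm z < 1 \<Longrightarrow> (F1 has_field_derivative F2 z) (at z)"
    "\<And>z. norm z < 1 \<Longrightarrow> z * (1 - z) * F2 z + (c - (a + b + 1) * z) * F1 z - a * b * hyp2F1 a b c z = 0"
    using hyp2F1_ode[OF nz] by metis
  define F where "F = hyp2F1 a b c"
  define U where "U = {u \<in> disc. norm (R_oct u) < 1}"
  have cont: "continuous_on disc R_oct"
    using R_oct_deriv disc_nonzero(2) DERIV_isCont by (intro continuous_at_imp_continuous_on) blast
  hence "open U"
    using continuous_open_preimage[OF cont open_disc, of "ball 0 1"]
    by (simp add: U_def vimage_def Int_def)
  have y: "hyp_near_0 n m = (\<lambda>u. p_e u powr al * F (R_oct u))"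
  proof -
    have "- 1/24 - of_int m / 2 - of_int n / 2 = a" "11/24 - of_int m / 2 - of_int n / 2 = b"
      by (simp_all add: a_def b_def al_def field_simps)
    thus ?thesis by (simp add: fun_eq_iff hyp_near_0_def F_def c_def al_def)
  qed
  define g where "g = dlog 0 al 0"
  define E where "E = (\<lambda>u. p_e u powr al)"
  have R0: "R_oct 0 = 0" by (simp add: R_oct_def p_v_def)
  hence U: "open U" "0 \<in> U" using \<open>open U\<close> by (auto simp: U_def)
  have gE: "g u = al * (p_e' u / p_e u)" for u by (simp add: g_def dlog_def)
  have ED: "(E has_field_derivative E u * g u) (at u)" if "u \<in> U" for u
  proof -
    have "p_e u \<notin> \<real>\<^sub>\<le>\<^sub>0" using Re_p_e_pos[of u] that by (auto simp: U_def complex_nonpos_Reals_iff)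
    moreover have "p_e u \<noteq> 0" using disc_nonzero(2) that by (auto simp: U_def)
    ultimately show ?thesis
      unfolding E_def gE by (auto intro!: derivative_eq_intros chain_derivs simp: powr_diff)
  qed
  have RD: "(R_oct has_field_derivative R_oct' u) (at u)" if "u \<in> U" for u
    using that disc_nonzero(2) by (auto simp: U_def intro: R_oct_deriv)
  define S where "S = (\<lambda>u. R_oct' u * (- 3 / (1 - u) + 2 * (p_f' u / p_f u) - 3 * (p_e' u / p_e u)))"
  have R'D: "(R_oct' has_field_derivative S u) (at u)" if "u \<in> U" for u
    unfolding S_def using that by (intro R_oct'_deriv disc_nonzero) (auto simp: U_def)
  have FD: "((\<lambda>u. F (R_oct u)) has_field_derivative F1 (R_oct u) * R_oct' u) (at u)"
    "((\<lambda>u. F1 (R_oct u)) has_field_derivative F2 (R_oct u) * R_oct' u) (at u)" if "u \<in> U" for u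
  proof -
    have n: "norm (R_oct u) < 1" using that by (simp add: U_def)
    show "((\<lambda>u. F (R_oct u)) has_field_derivative F1 (R_oct u) * R_oct' u) (at u)"
      by (rule DERIV_chain2[OF F(1)[OF n, folded F_def] RD[OF that]])
    show "((\<lambda>u. F1 (R_oct u)) has_field_derivative F2 (R_oct u) * R_oct' u) (at u)"
      by (rule DERIV_chain2[OF F(2)[OF n] RD[OF that]])
  qed
  have y1: "(hyp_near_0 n m has_field_derivative
      E u * (g u * F (R_oct u) + R_oct' u * F1 (R_oct u))) (at u)" if u: "u \<in> U" for u
    unfolding y E_def[symmetric]
    by (rule derivative_eq_intros ED[unfolded E_def] FD u refl | simp add: algebra_simps E_def)+
  hence "hyp_near_0 n m holomorphic_on U"
    using U(1) by (auto simp: holomorphic_on_open)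
  thus "hyp_near_0 n m analytic_on {0}" using U by (auto simp: analytic_at)
  show "hyp_near_0 n m 0 = 1" by (simp add: y R0 F_def p_e_def)
  have "deriv (deriv (hyp_near_0 n m)) u + P_cx (of_int n) (of_int m) u * deriv (hyp_near_0 n m) u
       + Q_cx (of_int n) (of_int m) u * hyp_near_0 n m u = 0" if u: "u \<in> U - {0}" for u
  proof -
    have uU: "u \<in> U" using u by simp
    have nz: "u \<noteq> 0" "1 - u \<noteq> 0" "p_e u \<noteq> 0" "p_f u \<noteq> 0"
      using u disc_nonzero[of u] by (auto simp: U_def)
    have gD: "(g has_field_derivative ddlog 0 al 0 u) (at u)"
      unfolding g_def by (rule dlog_deriv[OF nz])
    have d1: "deriv (hyp_near_0 n m) w = E w * (g w * F (R_oct w) + R_oct' w * F1 (R_oct w))" if "w \<in> U" for w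
      using y1[OF that] by (rule DERIV_imp_deriv)
    have "((\<lambda>w. E w * (g w * F (R_oct w) + R_oct' w * F1 (R_oct w))) has_field_derivative
       E u * g u * (g u * F (R_oct u) + R_oct' u * F1 (R_oct u))
        + E u * (ddlog 0 al 0 u * F (R_oct u) + g u * (F1 (R_oct u) * R_oct' u) + S u * F1 (R_oct u)
           + R_oct' u * (F2 (R_oct u) * R_oct' u))) (at u)"
      by (rule derivative_eq_intros ED FD gD R'D uU refl | simp add: algebra_simps)+
    from has_field_derivative_transform_within_open[OF this U(1) uU, where g = "deriv (hyp_near_0 n m)"]
    have d2: "deriv (deriv (hyp_near_0 n m)) u = E u * g u * (g u * F (R_oct u) + R_oct' u * F1 (R_oct u))
        + E u * (ddlog 0 al 0 u * F (R_oct u) + g u * (F1 (R_oct u) * R_oct' u) + S u * F1 (R_oct u)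
           + R_oct' u * (F2 (R_oct u) * R_oct' u))"
      using d1 by (intro DERIV_imp_deriv) auto
    define \<rho> where "\<rho> = p_e u / (u * (1 - u) * p_f u)"
    define z where "z = R_oct u"
    define P where "P = P_cx (of_int n) (of_int m) u"
    define Q where "Q = Q_cx (of_int n) (of_int m) u"
    define h where "h = ddlog 0 al 0 u"
    define t where "t = - 3 / (1 - u) + 2 * (p_f' u / p_f u) - 3 * (p_e' u / p_e u)"
    have c0: "g u ^ 2 + h + P * g u + Q = - (R_oct' u * \<rho> * (a * b))"
      unfolding P_def Q_def h_def \<rho>_def a_def b_def g_def by (rule pullback_coeff_0[OF nz]) (simp add: al_def)
    have c1: "2 * g u + t + P = \<rho> * (c - (a + b + 1) * z)"
    proof -
      have s: "a + b + 1 = 3/2 - al" by (simp add: a_def b_def)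
      show ?thesis
        unfolding P_def t_def \<rho>_def g_def z_def s c_def
        by (rule pullback_coeff_1[OF nz]) (simp add: al_def)
    qed
    have yu: "hyp_near_0 n m u = E u * F z" by (simp add: y E_def z_def)
    have sq: "R_oct' u ^ 2 = z * (1 - z) * (R_oct' u * \<rho>)"
      unfolding z_def \<rho>_def by (rule R_oct'_sq[OF nz])
    have ode: "z * (1 - z) * F2 z + (c - (a + b + 1) * z) * F1 z - a * b * F z = 0"
      using F(3)[of z] uU by (simp add: z_def U_def F_def)
    \<comment> \<open>Collecting the terms by \<open>F\<close>, \<open>F1\<close> and
      \<open>F2\<close> exposes exactly the three coefficients computed above.\<close>
    have "deriv (deriv (hyp_near_0 n m)) u + P * deriv (hyp_near_0 n m) u + Q * hyp_near_0 n m u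
      = E u * ((g u ^ 2 + h + P * g u + Q) * F z + R_oct' u * (2 * g u + t + P) * F1 z + R_oct' u ^ 2 * F2 z)"
      unfolding d2 d1[OF uU] yu z_def[symmetric] h_def[symmetric] S_def t_def[symmetric]
      by (simp add: algebra_simps power2_eq_square)
    also have "\<dots> = E u * (R_oct' u * \<rho>) * (z * (1 - z) * F2 z + (c - (a + b + 1) * z) * F1 z - a * b * F z)"
      unfolding c0 c1 sq by (simp add: algebra_simps)
    finally show ?thesis by (simp add: ode P_def Q_def)
  qed
  thus "\<forall>\<^sub>F u in at 0. deriv (deriv (hyp_near_0 n m)) u + P_cx (of_int n) (of_int m) u * deriv (hyp_near_0 n m) u
       + Q_cx (of_int n) (of_int m) u * hyp_near_0 n m u = 0"
    using eventually_at_in_open[OF U] by (auto elim: eventually_mono)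
qed

section \<open>Shifting the parameters\<close>

text \<open>Both forms of rationality are kept: the lowest-terms one for the definite description in
  \<open>octahedral\<close>, the other for applying a further step.\<close>

definition octahedral_germ :: "int \<Rightarrow> int \<Rightarrow> (complex \<Rightarrow> complex) \<Rightarrow> bool" where
  "octahedral_germ n m r \<longleftrightarrow> rational_function r \<and> regular_rational r \<and> sol_disc (of_int n) (of_int m) r \<and> r 0 = 1"

lemma regular_rational_analytic: "regular_rational r \<Longrightarrow> r analytic_on {0}"
  using regular_rational_holomorphic[of r] open_reg disc_subset_reg zero_in_disc
  unfolding analytic_at by blast

lemma sol_disc_eventually:
  assumes "sol_disc N M r"
  shows "\<forall>\<^sub>F u in at 0. deriv (deriv r) u + P_cx N M u * deriv r u + Q_cx N M u * r u = 0"
  using eventually_at_in_open[OF open_disc zero_in_disc] assms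
  by (auto simp: sol_disc_def elim: eventually_mono)

text \<open>\<open>r\<close> and \<open>hyp_near_0\<close> are holomorphic solutions with the same
  value at 0, hence the same germ. A competing rational function has this germ too, because the
  power of \<open>p_e\<close> does not vanish near 0.\<close>

lemma octahedral_eqI:
  assumes "octahedral_germ n m r"
  shows "octahedral n m = r"
proof -
  have r: "rational_function r" "regular_rational r" "sol_disc (of_int n) (of_int m) r" "r 0 = 1"
    using assms by (auto simp: octahedral_germ_def)
  have ev: "\<forall>\<^sub>F u in nhds 0. hyp_near_0 n m u = r u"
    using r by (intro frobenius_unique_0[where N = "of_int n" and m = m] hyp_near_0 sol_disc_eventually
        regular_rational_analytic) (auto simp: hyp_near_0)
  have disc: "\<forall>\<^sub>F u in nhds 0. u \<in> disc" by (intro eventually_nhds_in_open) auto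
  define A where "A = (\<lambda>u. hyp2F1 (- 1/24 - of_int m / 2 - of_int n / 2) (11/24 - of_int m / 2 - of_int n / 2)
               (3/4 - of_int m) (R_oct u))"
  have A: "hyp2F1 (- 1/24 - of_int m / 2 - of_int n / 2) (11/24 - of_int m / 2 - of_int n / 2)
               (3/4 - of_int m) (R_oct u) = A u" for u
    unfolding A_def ..
  have hyp: "\<forall>\<^sub>F u in nhds 0. A u = p_e u powr (- 1/12 - of_int m - of_int n) * r u"
    using ev disc
  proof eventually_elim
    case (elim u)
    have "p_e u \<noteq> 0" using elim(2) by (rule disc_nonzero)
    hence "p_e u powr (- 1/12 - of_int m - of_int n) * p_e u powr (1/12 + of_int m + of_int n) = 1"
      by (simp flip: powr_add)
    moreover have "r u = p_e u powr (1/12 + of_int m + of_int n) * A u"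
      using elim(1) unfolding hyp_near_0_def A_def by simp
    ultimately show ?case by (simp only: mult.assoc[symmetric] mult_1_left)
  qed
  show ?thesis
    unfolding octahedral_def A
  proof (rule the_equality)
    show "rational_function r \<and> (\<forall>\<^sub>F u in nhds 0. A u = p_e u powr (- 1/12 - of_int m - of_int n) * r u)"
      using r hyp by blast
    fix s assume s: "rational_function s \<and> (\<forall>\<^sub>F u in nhds 0. A u = p_e u powr (- 1/12 - of_int m - of_int n) * s u)"
    have "\<forall>\<^sub>F u in nhds 0. s u = r u"
      using disc hyp s [THEN conjunct2]
    proof eventually_elim
      case (elim u)
      have "p_e u powr (- 1/12 - of_int m - of_int n) \<noteq> 0"
        using disc_nonzero(2)[OF elim(1)] by simp
      thus ?case using elim(2,3) by (simp only: mult_cancel_left) blast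
    qed
    thus "s = r" using s r by (intro rational_function_unique) auto
  qed
qed

text \<open>For \<open>k = 1\<close> the factor \<open>u\<close> leaves only the residue
  \<open>sv / 4\<close> of \<open>g\<close>, times 4. For \<open>k = 0\<close> the derivative
  survives; 14 and -33 are the logarithmic derivatives of \<open>p_f\<close> and \<open>p_e\<close>
  at 0.\<close>

lemma step_op_0:
  assumes "e = 0 \<longrightarrow> se = 0" "e = 0 \<or> e = 1"
  shows "step_op 0 e j 0 se sf r 0 = 4 * deriv r 0 + 4 * (14 * sf - 33 * se) * r 0"
    and "step_op 1 e j sv se sf r 0 = sv * r 0"
  using assms
  by (auto simp: step_op_def step_factor_def p_e_def p_e'_def p_f_def p_f'_def algebra_simps)

text \<open>Apply the operator, divide by \<open>K\<close> to restore the value 1 at the origin, and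
  reduce the fraction. The constants \<open>c\<close> and \<open>c'\<close> are separate because the
  two ladders deliver the same number in different written forms.\<close>

lemma octahedral_germ_step:
  assumes octahedral_germ: "octahedral_germ n m r"
    and l1: "ladder (of_int n) (of_int m) sv se sf k j k' j' e c"
    and l2: "ladder (of_int n') (of_int m') sv' se' sf' k' j' k j e c'"
    and nz: "c' = c" "c \<noteq> 0" "K \<noteq> 0"
    and sums: "sv + sv' + (4 * of_nat k - 3) = - 4 * of_int m" "se + se' + of_nat e = 0"
      "sf + sf' + of_int j = - 3 * of_int n"
      "sv' + sv + (4 * of_nat k' - 3) = - 4 * of_int m'" "sf' + sf + of_int j' = - 3 * of_int n'"
    and adm: "k = 0 \<longrightarrow> sv = 0" "e = 0 \<longrightarrow> se = 0"
    and K: "step_op k e j sv se sf r 0 = K"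
  shows "\<exists>r'. octahedral_germ n' m' r' \<and> (\<forall>u\<in>disc. K * r' u = step_op k e j sv se sf r u)"
proof -
  define s where "s = step_op k e j sv se sf r"
  have r: "regular_rational r" "sol_disc (of_int n) (of_int m) r" using octahedral_germ by (auto simp: octahedral_germ_def)
  have s: "regular_rational s" unfolding s_def using r(1) by (rule regular_rational_step_op)
  hence hol: "s holomorphic_on disc"
    using regular_rational_holomorphic disc_subset_reg holomorphic_on_subset by blast
  have ode: "sol_disc (of_int n') (of_int m') s"
  proof (rule ladder_step[OF r(2) hol l1 l2[unfolded nz(1)] nz(2) sums(1-4) _ sums(5)])
    show "se' + se + of_nat e = 0" using sums(2) by (simp add: add_ac)
    show "s u = step_factor k e j u * (deriv r u + dlog sv se sf u * r u)" if "u \<in> disc - {0}" for u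
      unfolding s_def using that adm by (intro step_op_dlog) (auto dest: disc_nonzero)
  qed
  have "regular_rational (\<lambda>u. s u / K)"
    using regular_rational_mult[OF s regular_rational_const[of "1 / K"]] by simp
  then obtain r' where r': "rational_function r'" "regular_rational r'" "\<And>u. u \<in> reg \<Longrightarrow> r' u = s u / K"
    by (rule regular_rational_lowest_terms) blast
  have eq: "r' u = s u / K" if "u \<in> disc" for u using r'(3) that disc_subset_reg by blast
  have hol': "r' holomorphic_on disc"
    using regular_rational_holomorphic[OF r'(2)] disc_subset_reg holomorphic_on_subset by blast
  have d1: "deriv r' u = deriv s u / K" if "u \<in> disc" for u
  proof -
    have "deriv r' u = deriv (\<lambda>u. s u / K) u"
      using eventually_nhds_in_open[OF open_disc that]
      by (intro deriv_cong_ev refl) (auto elim!: eventually_mono simp: eq)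
    also have "\<dots> = deriv s u / K"
      using hol that by (intro deriv_cdivide_right holomorphic_on_imp_differentiable_at[of _ disc]) auto
    finally show ?thesis .
  qed
  have d2: "deriv (deriv r') u = deriv (deriv s) u / K" if "u \<in> disc" for u
  proof -
    have "deriv (deriv r') u = deriv (\<lambda>u. deriv s u / K) u"
      using eventually_nhds_in_open[OF open_disc that]
      by (intro deriv_cong_ev refl) (auto elim!: eventually_mono simp: d1)
    also have "\<dots> = deriv (deriv s) u / K"
      using hol that by (intro deriv_cdivide_right holomorphic_on_imp_differentiable_at[of _ disc] holomorphic_deriv) auto
    finally show ?thesis .
  qed
  have "sol_disc (of_int n') (of_int m') r'"
    unfolding sol_disc_def
  proof (intro conjI ballI hol')
    fix u assume u: "u \<in> disc - {0}"
    hence "deriv (deriv r') u + P_cx (of_int n') (of_int m') u * deriv r' u + Q_cx (of_int n') (of_int m') u * r' u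
      = (deriv (deriv s) u + P_cx (of_int n') (of_int m') u * deriv s u + Q_cx (of_int n') (of_int m') u * s u) / K"
      by (simp add: d1 d2 eq add_divide_distrib)
    thus "deriv (deriv r') u + P_cx (of_int n') (of_int m') u * deriv r' u + Q_cx (of_int n') (of_int m') u * r' u = 0"
      using ode u by (simp add: sol_disc_def)
  qed
  moreover have "r' 0 = 1" using nz K by (simp add: eq s_def)
  ultimately show ?thesis
    using r' nz eq by (intro exI[of _ r']) (auto simp: octahedral_germ_def s_def)
qed

lemma octahedral_germ_deriv_0:
  assumes "octahedral_germ n m r"
  shows "deriv r 0 = (1 + 12 * of_int m + 12 * of_int n) * (2 * of_int m - 9 * of_int n) / (3 - 4 * of_int m)"
proof -
  have "of_int (3 - 4 * m) \<noteq> (0 :: complex)" unfolding of_int_eq_0_iff by presburger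
  hence "3 - 4 * of_int m \<noteq> (0 :: complex)" by simp
  moreover have "(3/4 - of_int m) * deriv r 0 = (1 + 12 * of_int m + 12 * of_int n) * (2 * of_int m - 9 * of_int n) / 4"
    using sol_disc_deriv_0[of "of_int n" "of_int m" r] assms by (simp add: octahedral_germ_def)
  hence "(3 - 4 * of_int m) * deriv r 0 = (1 + 12 * of_int m + 12 * of_int n) * (2 * of_int m - 9 * of_int n)"
    by (simp add: algebra_simps)
  ultimately show ?thesis by (simp add: eq_divide_eq mult.commute)
qed

text \<open>Each of these forms is odd at integers.\<close>

lemma linear_nonzero:
  fixes n m :: int
  defines "N \<equiv> of_int n :: complex" and "M \<equiv> of_int m :: complex"
  shows "1 + 4 * M \<noteq> 0 \<and> 4 * M - 3 \<noteq> 0 \<and> 1 + 12 * M + 12 * N \<noteq> 0 \<and> 7 - 12 * M + 12 * N \<noteq> 0 \<and>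
    - 11 + 12 * M + 12 * N \<noteq> 0 \<and> - 7 + 12 * M - 12 * N \<noteq> 0 \<and> - 19 + 12 * M - 12 * N \<noteq> 0"
proof -
  have "1 + 4 * m \<noteq> 0" "4 * m - 3 \<noteq> 0" "1 + 12 * m + 12 * n \<noteq> 0" "7 - 12 * m + 12 * n \<noteq> 0"
    "- 11 + 12 * m + 12 * n \<noteq> 0" "- 7 + 12 * m - 12 * n \<noteq> 0" "- 19 + 12 * m - 12 * n \<noteq> 0"
    by presburger+
  hence "of_int (1 + 4 * m) \<noteq> (0::complex)" "of_int (4 * m - 3) \<noteq> (0::complex)"
    "of_int (1 + 12 * m + 12 * n) \<noteq> (0::complex)" "of_int (7 - 12 * m + 12 * n) \<noteq> (0::complex)"
    "of_int (- 11 + 12 * m + 12 * n) \<noteq> (0::complex)" "of_int (- 7 + 12 * m - 12 * n) \<noteq> (0::complex)"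
    "of_int (- 19 + 12 * m - 12 * n) \<noteq> (0::complex)"
    by (simp_all only: of_int_eq_0_iff not_False_eq_True)
  thus ?thesis by (simp add: N_def M_def)
qed

lemma nonzero_intros:
  fixes a b :: complex
  shows "a \<noteq> 0 \<Longrightarrow> b \<noteq> 0 \<Longrightarrow> a * b \<noteq> 0" "a \<noteq> 0 \<Longrightarrow> b \<noteq> 0 \<Longrightarrow> a / b \<noteq> 0" "a \<noteq> 0 \<Longrightarrow> - a \<noteq> 0"
  by simp_all

section \<open>The eight shifts\<close>

text \<open>Here \<open>k = 1\<close>, so \<open>K\<close> is just \<open>sv\<close>. The shifts
  keep the form \<open>n + dn\<close>, \<open>m + dm\<close>, even with \<open>dn = 0\<close>, to
  match the recurrences.\<close>

lemma octahedral_germ_m_up: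
  assumes "octahedral_germ n m r"
  defines "N \<equiv> of_int n" and "M \<equiv> of_int m"
  shows "\<exists>r'. octahedral_germ (n + 0) (m + 1) r' \<and> (\<forall>u\<in>disc. - (1 + 4 * M) * r' u = step_op 1 0 1 (- 1 - 4 * M) 0 (5/8 + 3/2 * M - 3/2 * N) r u)"
  unfolding N_def M_def
proof (rule octahedral_germ_step[OF assms(1) ladder_m_up ladder_m_down], fold N_def M_def)
  show "step_op 1 0 1 (- 1 - 4 * M) 0 (5/8 + 3/2 * M - 3/2 * N) r 0 = - (1 + 4 * M)"
    using assms(1) by (subst step_op_0) (auto simp: octahedral_germ_def field_simps)
qed ((use linear_nonzero[of m n] linear_nonzero[of "m + 1" "n + 0"] in
      \<open>(simp add: M_def N_def; fail) | (intro nonzero_intros; simp add: M_def N_def algebra_simps; fail)\<close>)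
    | (simp add: M_def N_def field_simps; fail))+

text \<open>Here \<open>k = 0\<close>, so \<open>K\<close> contains \<open>deriv r 0\<close>; this
  is where the denominator \<open>4 * M - 3\<close> comes from.\<close>

lemma octahedral_germ_m_down:
  assumes "octahedral_germ n m r"
  defines "N \<equiv> of_int n" and "M \<equiv> of_int m"
  shows "\<exists>r'. octahedral_germ (n + 0) (m + - 1) r' \<and> (\<forall>u\<in>disc. 3 * (1 + 12 * M + 12 * N) * (7 - 12 * M + 12 * N) / (4 * M - 3) * r' u = step_op 0 0 1 0 0 (- 1/8 - 3/2 * M - 3/2 * N) r u)"
  unfolding N_def M_def
proof (rule octahedral_germ_step[OF assms(1) ladder_m_down ladder_m_up], fold N_def M_def)
  show "step_op 0 0 1 0 0 (- 1/8 - 3/2 * M - 3/2 * N) r 0 = 3 * (1 + 12 * M + 12 * N) * (7 - 12 * M + 12 * N) / (4 * M - 3)"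
    using assms(1) linear_nonzero[of m n]
    by (subst step_op_0) (simp_all add: octahedral_germ_def octahedral_germ_deriv_0[OF assms(1)] M_def N_def divide_simps, simp_all add: algebra_simps)
qed ((use linear_nonzero[of m n] linear_nonzero[of "m + - 1" "n + 0"] in
      \<open>(simp add: M_def N_def; fail) | (intro nonzero_intros; simp add: M_def N_def algebra_simps; fail)\<close>)
    | (simp add: M_def N_def field_simps; fail))+

lemma octahedral_germ_n_up:
  assumes "octahedral_germ n m r"
  defines "N \<equiv> of_int n" and "M \<equiv> of_int m"
  shows "\<exists>r'. octahedral_germ (n + 1) (m + 0) r' \<and> (\<forall>u\<in>disc. 1/6 * (7 - 12 * M + 12 * N) * r' u = step_op 1 0 1 (7/6 - 2 * M + 2 * N) 0 (- 1 - 3 * N) r u)"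
  unfolding N_def M_def
proof (rule octahedral_germ_step[OF assms(1) ladder_n_up ladder_n_down], fold N_def M_def)
  show "step_op 1 0 1 (7/6 - 2 * M + 2 * N) 0 (- 1 - 3 * N) r 0 = 1/6 * (7 - 12 * M + 12 * N)"
    using assms(1) by (subst step_op_0) (auto simp: octahedral_germ_def field_simps)
qed ((use linear_nonzero[of m n] linear_nonzero[of "m + 0" "n + 1"] in
      \<open>(simp add: M_def N_def; fail) | (intro nonzero_intros; simp add: M_def N_def algebra_simps; fail)\<close>)
    | (simp add: M_def N_def field_simps; fail))+

lemma octahedral_germ_n_down:
  assumes "octahedral_germ n m r"
  defines "N \<equiv> of_int n" and "M \<equiv> of_int m"
  shows "\<exists>r'. octahedral_germ (n + - 1) (m + 0) r' \<and> (\<forall>u\<in>disc. - (1/6) * (1 + 12 * M + 12 * N) * r' u = step_op 1 0 (-2) (- 1/6 - 2 * M - 2 * N) 0 0 r u)"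
  unfolding N_def M_def
proof (rule octahedral_germ_step[OF assms(1) ladder_n_down ladder_n_up], fold N_def M_def)
  show "step_op 1 0 (-2) (- 1/6 - 2 * M - 2 * N) 0 0 r 0 = - (1/6) * (1 + 12 * M + 12 * N)"
    using assms(1) by (subst step_op_0) (auto simp: octahedral_germ_def field_simps)
qed ((use linear_nonzero[of m n] linear_nonzero[of "m + 0" "n + - 1"] in
      \<open>(simp add: M_def N_def; fail) | (intro nonzero_intros; simp add: M_def N_def algebra_simps; fail)\<close>)
    | (simp add: M_def N_def field_simps; fail))+

lemma octahedral_germ_nm_up:
  assumes "octahedral_germ n m r"
  defines "N \<equiv> of_int n" and "M \<equiv> of_int m"
  shows "\<exists>r'. octahedral_germ (n + 1) (m + 1) r' \<and> (\<forall>u\<in>disc. - (1 + 4 * M) * r' u = step_op 1 1 1 (- 1 - 4 * M) (13/12 + M + N) (- 1 - 3 * N) r u)"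
  unfolding N_def M_def
proof (rule octahedral_germ_step[OF assms(1) ladder_nm_up ladder_nm_down], fold N_def M_def)
  show "step_op 1 1 1 (- 1 - 4 * M) (13/12 + M + N) (- 1 - 3 * N) r 0 = - (1 + 4 * M)"
    using assms(1) by (subst step_op_0) (auto simp: octahedral_germ_def field_simps)
qed ((use linear_nonzero[of m n] linear_nonzero[of "m + 1" "n + 1"] in
      \<open>(simp add: M_def N_def; fail) | (intro nonzero_intros; simp add: M_def N_def algebra_simps; fail)\<close>)
    | (simp add: M_def N_def field_simps; fail))+

lemma octahedral_germ_nm_down:
  assumes "octahedral_germ n m r"
  defines "N \<equiv> of_int n" and "M \<equiv> of_int m"
  shows "\<exists>r'. octahedral_germ (n + - 1) (m + - 1) r' \<and> (\<forall>u\<in>disc. 3 * (1 + 12 * M + 12 * N) * (- 11 + 12 * M + 12 * N) / (4 * M - 3) * r' u = step_op 0 1 (-2) 0 (- 1/12 - M - N) 0 r u)"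
  unfolding N_def M_def
proof (rule octahedral_germ_step[OF assms(1) ladder_nm_down ladder_nm_up], fold N_def M_def)
  show "step_op 0 1 (-2) 0 (- 1/12 - M - N) 0 r 0 = 3 * (1 + 12 * M + 12 * N) * (- 11 + 12 * M + 12 * N) / (4 * M - 3)"
    using assms(1) linear_nonzero[of m n]
    by (subst step_op_0) (simp_all add: octahedral_germ_def octahedral_germ_deriv_0[OF assms(1)] M_def N_def divide_simps, simp_all add: algebra_simps)
qed ((use linear_nonzero[of m n] linear_nonzero[of "m + - 1" "n + - 1"] in
      \<open>(simp add: M_def N_def; fail) | (intro nonzero_intros; simp add: M_def N_def algebra_simps; fail)\<close>)
    | (simp add: M_def N_def field_simps; fail))+

lemma octahedral_germ_n_down_m_up:
  assumes "octahedral_germ n m r"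
  defines "N \<equiv> of_int n" and "M \<equiv> of_int m"
  shows "\<exists>r'. octahedral_germ (n + - 1) (m + 1) r' \<and> (\<forall>u\<in>disc. - (1 + 4 * M) * r' u = step_op 1 1 (-2) (- 1 - 4 * M) (5/12 + M - N) 0 r u)"
  unfolding N_def M_def
proof (rule octahedral_germ_step[OF assms(1) ladder_n_down_m_up ladder_n_up_m_down], fold N_def M_def)
  show "step_op 1 1 (-2) (- 1 - 4 * M) (5/12 + M - N) 0 r 0 = - (1 + 4 * M)"
    using assms(1) by (subst step_op_0) (auto simp: octahedral_germ_def field_simps)
qed ((use linear_nonzero[of m n] linear_nonzero[of "m + 1" "n + - 1"] in
      \<open>(simp add: M_def N_def; fail) | (intro nonzero_intros; simp add: M_def N_def algebra_simps; fail)\<close>)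
    | (simp add: M_def N_def field_simps; fail))+

lemma octahedral_germ_n_up_m_down:
  assumes "octahedral_germ n m r"
  defines "N \<equiv> of_int n" and "M \<equiv> of_int m"
  shows "\<exists>r'. octahedral_germ (n + 1) (m + - 1) r' \<and> (\<forall>u\<in>disc. 3 * (- 7 + 12 * M - 12 * N) * (- 19 + 12 * M - 12 * N) / (4 * M - 3) * r' u = step_op 0 1 1 0 (7/12 - M + N) (- 1 - 3 * N) r u)"
  unfolding N_def M_def
proof (rule octahedral_germ_step[OF assms(1) ladder_n_up_m_down ladder_n_down_m_up], fold N_def M_def)
  show "step_op 0 1 1 0 (7/12 - M + N) (- 1 - 3 * N) r 0 = 3 * (- 7 + 12 * M - 12 * N) * (- 19 + 12 * M - 12 * N) / (4 * M - 3)"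
    using assms(1) linear_nonzero[of m n]
    by (subst step_op_0) (simp_all add: octahedral_germ_def octahedral_germ_deriv_0[OF assms(1)] M_def N_def divide_simps, simp_all add: algebra_simps)
qed ((use linear_nonzero[of m n] linear_nonzero[of "m + - 1" "n + 1"] in
      \<open>(simp add: M_def N_def; fail) | (intro nonzero_intros; simp add: M_def N_def algebra_simps; fail)\<close>)
    | (simp add: M_def N_def field_simps; fail))+

lemma octahedral_germ_exists: "\<exists>r. octahedral_germ n m r"
proof -
  \<comment> \<open>\<open>Q_cx 0 0\<close> vanishes identically, so constants solve the
    equation.\<close>
  have base: "octahedral_germ 0 0 (\<lambda>u. 1)"
    unfolding octahedral_germ_def rational_function_def sol_disc_def
    by (auto simp: Q_cx_def intro!: exI[of _ "1 :: complex poly"])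
  have m: "\<exists>r. octahedral_germ 0 m r" for m
  proof (induction m rule: int_induct[of _ 0])
    case base
    show ?case using \<open>octahedral_germ 0 0 (\<lambda>u. 1)\<close> by blast
  next
    case (step1 m)
    thus ?case using octahedral_germ_m_up[of 0 m] by fastforce
  next
    case (step2 m)
    thus ?case using octahedral_germ_m_down[of 0 m] by fastforce
  qed
  show ?thesis
  proof (induction n rule: int_induct[of _ 0])
    case base
    show ?case by (rule m)
  next
    case (step1 n)
    thus ?case using octahedral_germ_n_up[of n m] by fastforce
  next
    case (step2 n)
    thus ?case using octahedral_germ_n_down[of n m] by fastforce
  qed
qed

lemma octahedral_germ_octahedral: "octahedral_germ n m (octahedral n m)"
  using octahedral_germ_exists[of n m] octahedral_eqI by metis

lemma octahedral_step:
  assumes "\<exists>r'. octahedral_germ n' m' r' \<and> (\<forall>u\<in>disc. K * r' u = G u)"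
  shows "\<forall>u\<in>disc. K * octahedral n' m' u = G u"
  using assms octahedral_eqI by metis

section \<open>From rational operators back to fractional powers\<close>

lemma powr_of_int_eq_power_int: "(z :: complex) \<noteq> 0 \<Longrightarrow> z powr of_int i = z powi i"
  by (simp add: powr_of_int power_int_def power_inverse)

lemma Re_p_f_pos: "u \<in> disc \<Longrightarrow> Re (p_f u) > 0"
  using norm_p_f_minus_1[of u] abs_Re_le_cmod[of "p_f u - 1"] by simp

text \<open>On the positive axis the logarithm is additive without multiples of
  \<open>2 * pi * i\<close>, so the fractional parts of the exponents of \<open>u\<close>
  cancel.\<close>

lemma powr_step_v:
  fixes x :: real
  assumes x: "0 < x" "x < 1"
  defines "u \<equiv> complex_of_real x"
  shows "p_v u powr ((4 * of_nat k - 3) / 4) * u powr (3/4) = u ^ k * (1 - u) powi (4 * int k - 3)"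
proof -
  define y where "y = x * (1 - x) ^ 4"
  have y: "p_v u = of_real y" "y > 0" using x by (simp_all add: p_v_def u_def y_def)
  have u: "u \<noteq> 0" "1 - u \<noteq> 0" using x by (auto simp: u_def complex_eq_iff)
  have u1: "1 - u = of_real (1 - x)" by (simp add: u_def)
  have "ln y = ln x + 4 * ln (1 - x)"
    using x by (simp add: y_def ln_mult ln_realpow)
  hence L: "Ln (p_v u) = Ln u + 4 * Ln (1 - u)"
    using x y u1 by (simp add: u_def Ln_of_real del: of_real_diff)
  have nz: "p_v u \<noteq> 0" using y by simp
  have "p_v u powr ((4 * of_nat k - 3) / 4) * u powr (3/4)
    = exp ((4 * of_nat k - 3) / 4 * (Ln u + 4 * Ln (1 - u)) + 3/4 * Ln u)"
    using nz u by (simp add: powr_def L exp_add)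
  also have "(4 * of_nat k - 3) / 4 * (Ln u + 4 * Ln (1 - u)) + 3/4 * Ln u
      = of_nat k * Ln u + of_int (4 * int k - 3) * Ln (1 - u)"
    by (simp add: field_simps)
  also have "exp \<dots> = u powr of_nat k * (1 - u) powr of_int (4 * int k - 3)"
    using u unfolding exp_add by (simp add: powr_def)
  also have "u powr of_nat k = u ^ k" using u by simp
  also have "(1 - u) powr of_int (4 * int k - 3) = (1 - u) powi (4 * int k - 3)"
    using u(2) by (rule powr_of_int_eq_power_int)
  finally show ?thesis .
qed

lemma has_field_derivative_powr_log:
  fixes f :: "complex \<Rightarrow> complex"
  assumes "(f has_field_derivative f') (at u)" "f u \<notin> \<real>\<^sub>\<le>\<^sub>0"
  shows "((\<lambda>w. f w powr s) has_field_derivative f u powr s * (s * (f' / f u))) (at u)"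
proof -
  have "f u \<noteq> 0" using assms(2) by auto
  have "((\<lambda>w. f w powr s) has_field_derivative s * f u powr (s - 1) * f') (at u)"
    by (rule DERIV_chain2[OF has_field_derivative_powr[OF assms(2)] assms(1)])
  thus ?thesis using \<open>f u \<noteq> 0\<close> by (simp add: powr_diff mult_ac)
qed

text \<open>The fractional power \<open>\<phi>\<close> satisfies
  \<open>\<phi>' = \<phi> * g\<close>, and the prefactor of the recurrence times
  \<open>\<phi>\<close> is the rational \<open>B\<close>; so the right-hand side is the operator
  already studied.\<close>

lemma octahedral_recurrenceI:
  assumes step: "\<forall>u\<in>disc. K * octahedral (n + dn) (m + dm) u = step_op k e j sv se sf (octahedral n m) u"
    and adm: "k = 0 \<longrightarrow> sv = 0" "e = 0 \<longrightarrow> se = 0"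
    and eps: "ev = 4 * of_nat k - 3" "ee = of_nat e" "ef = of_int j"
  shows "octahedral_recurrence n m (dn, dm) (sv, se, sf) (ev, ee, ef) K"
proof -
  define r where "r = octahedral n m"
  have hol: "r holomorphic_on disc"
    using octahedral_germ_octahedral[of n m] by (simp add: r_def octahedral_germ_def sol_disc_def)
  have "K * octahedral (n + dn) (m + dm) u =
         p_v u powr ((- sv + ev) / 4) * p_e u powr (- se + ee) * p_f u powr (- sf + ef)
         * (4 * u powr (3/4))
         * deriv (\<lambda>w. p_v w powr (sv / 4) * p_e w powr se * p_f w powr sf * r w) u"
    if x: "0 < x" "x < 1/100" and u: "u = complex_of_real x" for x u
  proof -
    have disc: "u \<in> disc" using x by (simp add: u disc_def)
    have u0: "u \<noteq> 0" using x by (simp add: u)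
    note nz = u0 disc_nonzero[OF disc]
    have pv: "p_v u = of_real (x * (1 - x) ^ 4)" by (simp add: p_v_def u)
    have pv0: "p_v u \<notin> \<real>\<^sub>\<le>\<^sub>0" unfolding pv complex_nonpos_Reals_iff using x by (simp add: not_le)
    have pe0: "p_e u \<notin> \<real>\<^sub>\<le>\<^sub>0" using Re_p_e_pos[OF disc] by (simp add: complex_nonpos_Reals_iff not_le)
    have pf0: "p_f u \<notin> \<real>\<^sub>\<le>\<^sub>0"
      using Re_p_f_pos[OF disc] by (simp add: complex_nonpos_Reals_iff not_le)
    have pvD: "(p_v has_field_derivative (1 - u) ^ 3 * (1 - 5 * u)) (at u)"
      unfolding p_v_def [abs_def] by (auto intro!: derivative_eq_intros) algebra
    have l: "(1 - u) ^ 3 * (1 - 5 * u) / p_v u = 1 / u - 4 / (1 - u)"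
      using nz by (simp add: p_v_def divide_simps) (simp add: algebra_simps eval_nat_numeral)
    define \<phi> where "\<phi> = (\<lambda>w. p_v w powr (sv / 4) * p_e w powr se * p_f w powr sf)"
    have "(\<phi> has_field_derivative \<phi> u * (sv / 4 * (1 / u - 4 / (1 - u)) + se * (p_e' u / p_e u) + sf * (p_f' u / p_f u))) (at u)"
      unfolding \<phi>_def l[symmetric]
      by (intro log_deriv_mult has_field_derivative_powr_log pvD p_e_deriv p_f_deriv pv0 pe0 pf0)
    hence "(\<phi> has_field_derivative \<phi> u * dlog sv se sf u) (at u)" by (simp add: dlog_def)
    moreover have "(r has_field_derivative deriv r u) (at u)"
      using hol open_disc disc by (rule holomorphic_derivI)
    ultimately have "((\<lambda>w. \<phi> w * r w) has_field_derivative \<phi> u * (deriv r u + dlog sv se sf u * r u)) (at u)"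
      by (auto intro!: derivative_eq_intros simp: algebra_simps)
    hence d: "deriv (\<lambda>w. \<phi> w * r w) u = \<phi> u * (deriv r u + dlog sv se sf u * r u)"
      by (rule DERIV_imp_deriv)
    define V where "V = p_v u powr (sv / 4)"
    \<comment> \<open>Principal powers of one base combine freely; merging the different bases
      \<open>p_v u\<close> and \<open>u\<close> is left to \<open>powr_step_v\<close>, which uses
      that \<open>u\<close> is positive.\<close>
    have V: "p_v u powr ((- sv + ev) / 4) * V = p_v u powr (ev / 4)"
      unfolding V_def by (simp flip: powr_add add: add_divide_distrib diff_divide_distrib)
    have E: "p_e u powr (- se + ee) * p_e u powr se = p_e u ^ e"
      using nz by (simp flip: powr_add add: eps)
    have F: "p_f u powr (- sf + ef) * p_f u powr sf = p_f u powi j"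
      using nz by (simp flip: powr_add add: eps powr_of_int_eq_power_int)
    have "p_v u powr ((- sv + ev) / 4) * p_e u powr (- se + ee) * p_f u powr (- sf + ef)
         * (4 * u powr (3/4)) * deriv (\<lambda>w. \<phi> w * r w) u
       = 4 * ((p_v u powr ((- sv + ev) / 4) * V) * u powr (3/4)) * (p_e u powr (- se + ee) * p_e u powr se)
          * (p_f u powr (- sf + ef) * p_f u powr sf) * (deriv r u + dlog sv se sf u * r u)"
      unfolding d by (simp only: \<phi>_def V_def mult_ac)
    also have "p_v u powr ((- sv + ev) / 4) * V * u powr (3/4) = u ^ k * (1 - u) powi (4 * int k - 3)"
      unfolding V unfolding eps u using x by (intro powr_step_v) auto
    finally have "p_v u powr ((- sv + ev) / 4) * p_e u powr (- se + ee) * p_f u powr (- sf + ef)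
         * (4 * u powr (3/4)) * deriv (\<lambda>w. \<phi> w * r w) u = step_op k e j sv se sf r u"
      unfolding E F step_op_dlog[OF nz(1-4) adm] step_factor_def by (simp only: mult_ac)
    thus ?thesis using step disc by (simp add: r_def \<phi>_def)
  qed
  hence "\<forall>\<^sub>F x in at_right 0. let u = complex_of_real x in K * octahedral (n + dn) (m + dm) u =
         p_v u powr ((- sv + ev) / 4) * p_e u powr (- se + ee) * p_f u powr (- sf + ef)
         * (4 * u powr (3/4))
         * deriv (\<lambda>w. p_v w powr (sv / 4) * p_e w powr se * p_f w powr sf * r w) u"
    unfolding Let_def eventually_at_right_field by (intro exI[of _ "1/100"]) auto
  thus ?thesis unfolding octahedral_recurrence_def r_def by simp
qed

section \<open>Characteristic exponents\<close>

text \<open>At most a simple pole of \<open>Q\<close> contributes nothing to the indicial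
  polynomial, which becomes \<open>\<rho> * (\<rho> - 1 + c)\<close> with \<open>c\<close> the
  residue of \<open>P\<close>.\<close>

lemma char_exponents_simple:
  assumes an: "f analytic_on {a}" "g analytic_on {a}"
    and ev: "\<forall>\<^sub>F u in at a. P u = c / (u - a) + f u \<and> Q u = g u / (u - a)"
  shows "char_exponents P Q a 0 (1 - c)"
  unfolding char_exponents_def has_indicial_poly_def
proof (intro exI conjI)
  show "(\<lambda>u. c + (u - a) * f u) analytic_on {a}" "(\<lambda>u. (u - a) * g u) analytic_on {a}"
    by (intro analytic_intros an)+
  show "\<forall>\<^sub>F u in at a. P u = (c + (u - a) * f u) / (u - a) \<and> Q u = (u - a) * g u / (u - a) ^ 2"
    using ev eventually_neq_at_within[of a a UNIV]
  proof eventually_elim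
    case (elim u)
    hence "u - a \<noteq> 0" by simp
    thus ?case using elim by (simp add: add_divide_distrib power2_eq_square)
  qed
  show "[:- 0, 1:] * [:- (1 - c), 1:] = [:(a - a) * g a, c + (a - a) * f a - 1, 1:]" by simp
qed

lemma p_f_roots:
  "p_f u = (u + (2 + of_real (sqrt 3)) ^ 2) * (u + (2 - of_real (sqrt 3)) ^ 2)"
proof -
  define s :: complex where "s = of_real (sqrt 3)"
  have s: "s * s = 3" unfolding s_def by (simp flip: of_real_mult)
  have "(2 + s) ^ 2 = 7 + 4 * s" "(2 - s) ^ 2 = 7 - 4 * s"
    by (simp_all add: power2_eq_square algebra_simps s)
  \<comment> \<open>The vanishing summand \<open>16 * (s * s - 3)\<close> makes this an identity for
    arbitrary \<open>s\<close>.\<close>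
  moreover have "p_f u = (u + (7 + 4 * s)) * (u + (7 - 4 * s)) + 16 * (s * s - 3)"
    by (simp add: p_f_def power2_eq_square algebra_simps)
  ultimately show ?thesis by (simp add: s_def [symmetric] s)
qed

lemma indicial_of_ordinary:
  assumes "ordinary_point P Q a"
  shows "\<exists>I. has_indicial_poly P Q a I"
proof -
  obtain p q where an: "p analytic_on {a}" "q analytic_on {a}"
      and ev: "\<forall>\<^sub>F u in at a. P u = p u \<and> Q u = q u"
    using assms unfolding ordinary_point_def by blast
  have "\<forall>\<^sub>F u in at a. P u = (u - a) * p u / (u - a) \<and> Q u = (u - a) ^ 2 * q u / (u - a) ^ 2"
    using ev eventually_neq_at_within[of a a UNIV] by eventually_elim auto
  thus ?thesis
    unfolding has_indicial_poly_def
    by (intro exI[of _ "[:(a - a) ^ 2 * q a, (a - a) * p a - 1, 1:]"] exI[of _ "\<lambda>u. (u - a) * p u"]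
        exI[of _ "\<lambda>u. (u - a) ^ 2 * q u"] conjI refl analytic_intros an)
qed

lemma ordinary_point_cx:
  assumes "a \<noteq> 0" "1 - a \<noteq> 0" "p_f a \<noteq> 0"
  shows "ordinary_point (P_cx N M) (Q_cx N M) a"
  unfolding ordinary_point_def
  using assms
  by (intro exI[of _ "P_cx N M"] exI[of _ "Q_cx N M"])
     (auto simp: P_cx_def [abs_def] Q_cx_def [abs_def] p_f_def p_f'_def intro!: analytic_intros)

lemma char_exponents_0: "char_exponents (P_cx N M) (Q_cx N M) 0 0 (1/4 + M)"
proof -
  have "char_exponents (P_cx N M) (Q_cx N M) 0 0 (1 - (3/4 - M))"
  proof (rule char_exponents_simple)
    show "(\<lambda>u. 4 * M / (1 - u) - 3 * N * (p_f' u / p_f u)) analytic_on {0}"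
      by (auto simp: p_f_def p_f'_def intro!: analytic_intros)
    show "(\<lambda>u. - ((1 + 12 * M + 12 * N) * ((2 * M + 3 * N) * p_f u - 12 * N * (3 * u + 1))
       / (4 * (1 - u) * p_f u))) analytic_on {0}"
      by (auto simp: p_f_def intro!: analytic_intros)
  qed (auto simp: P_cx_def Q_cx_def mult_ac)
  thus ?thesis by (simp add: algebra_simps)
qed

lemma char_exponents_1: "char_exponents (P_cx N M) (Q_cx N M) 1 0 (1 + 4 * M)"
proof -
  have "char_exponents (P_cx N M) (Q_cx N M) 1 0 (1 - (- 4 * M))"
  proof (rule char_exponents_simple)
    show "(\<lambda>u. (3/4 - M) / u - 3 * N * (p_f' u / p_f u)) analytic_on {1}"
      by (auto simp: p_f_def p_f'_def intro!: analytic_intros)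
    show "(\<lambda>u. (1 + 12 * M + 12 * N) * ((2 * M + 3 * N) * p_f u - 12 * N * (3 * u + 1))
       / (4 * u * p_f u)) analytic_on {1}"
      by (auto simp: p_f_def intro!: analytic_intros)
    show "\<forall>\<^sub>F u in at 1. P_cx N M u = - 4 * M / (u - 1) + ((3/4 - M) / u - 3 * N * (p_f' u / p_f u)) \<and>
       Q_cx N M u = (1 + 12 * M + 12 * N) * ((2 * M + 3 * N) * p_f u - 12 * N * (3 * u + 1))
       / (4 * u * p_f u) / (u - 1)"
    proof (intro always_eventually allI conjI)
      fix u :: complex
      have 1: "4 * M / (1 - u) = - 4 * M / (u - 1)"
        by (metis minus_diff_eq minus_divide_divide mult_minus_left)
      show "P_cx N M u = - 4 * M / (u - 1) + ((3/4 - M) / u - 3 * N * (p_f' u / p_f u))"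
        unfolding P_cx_def 1 by simp
      have 2: "4 * u * (1 - u) * p_f u = - (4 * u * p_f u * (u - 1))" by (simp add: algebra_simps)
      show "Q_cx N M u = (1 + 12 * M + 12 * N) * ((2 * M + 3 * N) * p_f u - 12 * N * (3 * u + 1))
       / (4 * u * p_f u) / (u - 1)"
        unfolding Q_cx_def 2 by simp
    qed
  qed
  thus ?thesis by simp
qed

text \<open>At a simple root of \<open>p_f\<close> the logarithmic derivative has residue 1, so
  \<open>P\<close> has residue \<open>- 3 * N\<close>.\<close>

lemma char_exponents_root:
  assumes roots: "\<And>u. p_f u = (u - a) * (u - b)" and nz: "a \<noteq> b" "a \<noteq> 0" "a \<noteq> 1"
  shows "char_exponents (P_cx N M) (Q_cx N M) a 0 (1 + 3 * N)"
proof -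
  have p': "p_f' u = (u - a) + (u - b)" for u
  proof -
    have "p_f u - p_f 0 = (u - a) * (u - b) - a * b" for u by (simp add: roots)
    from this[of 1] have "a + b + 14 = 0" by (simp add: p_f_def algebra_simps)
    hence "a + b = - 14" by (simp only: eq_neg_iff_add_eq_0)
    thus ?thesis by (simp add: p_f'_def algebra_simps)
  qed
  have "char_exponents (P_cx N M) (Q_cx N M) a 0 (1 - (- 3 * N))"
  proof (rule char_exponents_simple)
    show "(\<lambda>u. (3/4 - M) / u + 4 * M / (1 - u) - 3 * N / (u - b)) analytic_on {a}"
      using nz by (auto intro!: analytic_intros)
    show "(\<lambda>u. - ((1 + 12 * M + 12 * N) * ((2 * M + 3 * N) * p_f u - 12 * N * (3 * u + 1))
       / (4 * u * (1 - u) * (u - b)))) analytic_on {a}"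
      using nz by (auto simp: p_f_def intro!: analytic_intros)
    show "\<forall>\<^sub>F u in at a. P_cx N M u = - 3 * N / (u - a) + ((3/4 - M) / u + 4 * M / (1 - u) - 3 * N / (u - b)) \<and>
       Q_cx N M u = - ((1 + 12 * M + 12 * N) * ((2 * M + 3 * N) * p_f u - 12 * N * (3 * u + 1))
       / (4 * u * (1 - u) * (u - b))) / (u - a)"
      using eventually_neq_at_within[of a a UNIV] eventually_neq_at_within[of b a UNIV]
    proof eventually_elim
      case (elim u)
      have "p_f' u / p_f u = 1 / (u - a) + 1 / (u - b)"
        unfolding p' roots using elim by (simp add: add_frac_eq add.commute)
      hence 1: "3 * N * (p_f' u / p_f u) = 3 * N / (u - a) + 3 * N / (u - b)"
        by (simp add: distrib_left)
      have "P_cx N M u = - 3 * N / (u - a) + ((3/4 - M) / u + 4 * M / (1 - u) - 3 * N / (u - b))"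
        unfolding P_cx_def 1 by simp
      moreover have 2: "4 * u * (1 - u) * p_f u = 4 * u * (1 - u) * (u - b) * (u - a)"
        by (simp add: roots)
      have "Q_cx N M u = - ((1 + 12 * M + 12 * N) * ((2 * M + 3 * N) * p_f u - 12 * N * (3 * u + 1))
       / (4 * u * (1 - u) * (u - b))) / (u - a)"
        unfolding Q_cx_def 2 by simp
      ultimately show ?case by blast
    qed
  qed
  thus ?thesis by simp
qed

text \<open>The polynomial \<open>p_f\<close> is palindromic,
  \<open>p_f (1/t) = p_f t / t^2\<close>, so the coefficients at infinity have the same denominators
  in \<open>t\<close>.\<close>

lemma char_exponents_inf_cx:
  "char_exponents_inf (P_cx N M) (Q_cx N M) (- 1/4 - 3 * M - 3 * N) (- 2 * M - 3 * N)"
  unfolding char_exponents_inf_def char_exponents_def has_indicial_poly_def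
proof (intro exI conjI)
  define p where "p = (\<lambda>t. 5/4 + M + 4 * M / (1 - t) + 3 * N * (2 + 14 * t) / p_f t)"
  define q where "q = (\<lambda>t. (1 + 12 * M + 12 * N) * ((2 * M + 3 * N) * p_f t - 12 * N * t * (3 + t))
     / (4 * (1 - t) * p_f t))"
  show "p analytic_on {0}" "q analytic_on {0}"
    by (auto simp: p_def q_def p_f_def intro!: analytic_intros)
  show "[:- (- 1/4 - 3 * M - 3 * N), 1:] * [:- (- 2 * M - 3 * N), 1:] = [:q 0, p 0 - 1, 1:]"
    by (simp add: p_def q_def p_f_def field_simps)
  have "\<forall>\<^sub>F t in at 0. t \<in> disc - {0}"
    by (rule eventually_at_in_open) auto
  thus "\<forall>\<^sub>F t in at 0. P_inf (P_cx N M) t = p t / (t - 0) \<and> Q_inf (Q_cx N M) t = q t / (t - 0) ^ 2"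
  proof eventually_elim
    case (elim t)
    have t: "t \<noteq> 0" "1 - t \<noteq> 0" "p_f t \<noteq> 0" using elim disc_nonzero[of t] by auto
    have f: "p_f (1 / t) = p_f t / t ^ 2" and f': "p_f' (1 / t) = (2 + 14 * t) / t"
      and v: "1 - 1 / t = - (1 - t) / t"
      using t by (simp_all add: p_f_def p_f'_def field_simps power2_eq_square)
    have P: "P_cx N M (1 / t) = (3/4 - M) * t - 4 * M * t / (1 - t) - 3 * N * (2 + 14 * t) * t / p_f t"
    proof -
      have "4 * M / (1 - 1 / t) = - (4 * M * t / (1 - t))"
        unfolding v by (simp only: minus_divide_left [symmetric] divide_minus_right) simp
      thus ?thesis
        unfolding P_cx_def f f' using t by (simp add: power2_eq_square)
    qed
    have "P_inf (P_cx N M) t = p t / t"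
      unfolding P_inf_def P p_def using t by (simp add: divide_simps) (simp add: algebra_simps power2_eq_square)
    moreover have "4 * (1 / t) * (1 - 1 / t) * p_f (1 / t) = - (4 * (1 - t) * p_f t) / t ^ 4"
    proof -
      define w where "w = 1 - t"
      show ?thesis unfolding f v w_def[symmetric] using t by (simp add: eval_nat_numeral)
    qed
    hence Q: "Q_cx N M (1 / t) = (1 + 12 * M + 12 * N) * ((2 * M + 3 * N) * (p_f t / t ^ 2) - 12 * N * (3 * (1 / t) + 1))
         * t ^ 4 / (4 * (1 - t) * p_f t)"
      unfolding Q_cx_def f by simp
    have n: "(2 * M + 3 * N) * (p_f t / t ^ 2) - 12 * N * (3 * (1 / t) + 1)
       = ((2 * M + 3 * N) * p_f t - 12 * N * t * (3 + t)) / t ^ 2"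
      using t by (simp add: field_simps power2_eq_square)
    have "Q_inf (Q_cx N M) t = q t / t ^ 2"
      unfolding Q_inf_def Q q_def n using t by simp
    ultimately show ?case by simp
  qed
qed

lemma rational_coefficient_cx:
  "rational_coefficient (P_cx N M)" "rational_coefficient (Q_cx N M)"
proof -
  define q :: "complex poly" where "q = [:0, 1:] * [:1, -1:] * [:1, 14, 1:]"
  have q: "poly q u = u * (1 - u) * p_f u" for u
    by (simp add: q_def p_f_def algebra_simps power2_eq_square)
  have q0: "q \<noteq> 0" by (simp add: q_def)
  have P: "poly (smult (3/4 - M) ([:1, -1:] * [:1, 14, 1:]) + smult (4 * M) ([:0, 1:] * [:1, 14, 1:])
    - smult (3 * N) ([:14, 2:] * [:0, 1:] * [:1, -1:])) u = P_num N M u" for u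
    unfolding P_num_def p_f_def p_f'_def by simp algebra
  have Q: "poly (smult (- ((1 + 12 * M + 12 * N) / 4)) (smult (2 * M + 3 * N) [:1, 14, 1:] - smult (12 * N) [:1, 3:])) u
     = Q_num N M u" for u
    unfolding Q_num_def p_f_def by simp algebra
  have "P_cx N M u = P_num N M u / (u * (1 - u) * p_f u)" if "u * (1 - u) * p_f u \<noteq> 0" for u
    using that unfolding P_cx_def P_num_def by (simp add: add_divide_distrib diff_divide_distrib)
  thus "rational_coefficient (P_cx N M)"
    unfolding rational_coefficient_def using q0 P q by metis
  have "Q_cx N M u = Q_num N M u / (u * (1 - u) * p_f u)" for u
    unfolding Q_cx_def Q_num_def by simp
  thus "rational_coefficient (Q_cx N M)"
    unfolding rational_coefficient_def using q0 Q q by metis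
qed

section \<open>The equation on the whole plane and the Frobenius property\<close>

lemma PQ_holomorphic:
  "P_cx N M holomorphic_on reg - {0}" "Q_cx N M holomorphic_on reg - {0}"
proof -
  have "p_f holomorphic_on reg - {0}"
    unfolding p_f_def [abs_def] by (intro holomorphic_intros)
  moreover have "p_f' holomorphic_on reg - {0}"
    unfolding p_f'_def [abs_def] by (intro holomorphic_intros)
  ultimately show "P_cx N M holomorphic_on reg - {0}" "Q_cx N M holomorphic_on reg - {0}"
    unfolding P_cx_def [abs_def] Q_cx_def [abs_def]
    by (auto simp: reg_def intro!: holomorphic_intros)
qed

text \<open>Identity theorem: the left-hand side of the equation is holomorphic off a finite set,
  whose complement is connected, and vanishes on a punctured disc around the origin.\<close>

lemma solves_ode_octahedral:
  assumes S: "- S = reg - {0}" "finite S"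
  shows "solves_ode (P_cx (of_int n) (of_int m)) (Q_cx (of_int n) (of_int m)) (- S) (octahedral n m)"
proof -
  define r where "r = octahedral n m"
  define N M :: complex where "N = of_int n" and "M = of_int m"
  have octahedral_germ: "regular_rational r" "sol_disc N M r"
    using octahedral_germ_octahedral[of n m] by (simp_all add: octahedral_germ_def r_def N_def M_def)
  have op: "open (- S)" using S(2) by (simp add: finite_imp_closed open_Compl)
  have hol: "r holomorphic_on - S"
    using regular_rational_holomorphic[OF octahedral_germ(1)] S(1) by (auto intro: holomorphic_on_subset)
  have hol_ode: "(\<lambda>u. deriv (deriv r) u + P_cx N M u * deriv r u + Q_cx N M u * r u) holomorphic_on - S"
    by (intro holomorphic_on_add holomorphic_on_mult holomorphic_deriv hol op PQ_holomorphic[folded S(1)])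
  have "connected (UNIV - S)"
    using S(2) by (intro connected_open_delete_finite) auto
  hence conn: "connected (- S)" by (simp add: Compl_eq_Diff_UNIV)
  have "1/200 \<in> disc - {0}" by (simp add: disc_def norm_divide)
  hence ne: "disc - {0} \<noteq> {}" by blast
  have sub: "disc - {0} \<subseteq> - S" using disc_subset_reg unfolding S(1) by blast
  have zero: "deriv (deriv r) u + P_cx N M u * deriv r u + Q_cx N M u * r u = 0" if "u \<in> disc - {0}" for u
    using octahedral_germ(2) that unfolding sol_disc_def by blast
  have "deriv (deriv r) u + P_cx N M u * deriv r u + Q_cx N M u * r u = 0" if "u \<in> - S" for u
    by (rule analytic_continuation_open[OF _ op ne conn sub hol_ode holomorphic_on_const zero that])
      (simp_all add: open_Diff)
  thus ?thesis using hol
    unfolding solves_ode_def by (simp add: numeral_2_eq_2 r_def N_def M_def)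
qed

lemma frobenius_octahedral:
  shows "frobenius_solution_zero (P_cx (of_int n) (of_int m)) (Q_cx (of_int n) (of_int m)) 0 (octahedral n m)"
    and "frobenius_solution_zero (P_cx (of_int n) (of_int m)) (Q_cx (of_int n) (of_int m)) 0 y
      \<Longrightarrow> \<forall>\<^sub>F u in nhds 0. y u = octahedral n m u"
proof -
  have octahedral_germ: "regular_rational (octahedral n m)" "sol_disc (of_int n) (of_int m) (octahedral n m)"
    "octahedral n m 0 = 1"
    using octahedral_germ_octahedral[of n m] by (simp_all add: octahedral_germ_def)
  show "frobenius_solution_zero (P_cx (of_int n) (of_int m)) (Q_cx (of_int n) (of_int m)) 0 (octahedral n m)"
    unfolding frobenius_solution_zero_def
    using regular_rational_analytic[OF octahedral_germ(1)] sol_disc_eventually[OF octahedral_germ(2)] octahedral_germ(3)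
    by (simp add: numeral_2_eq_2)
  show "\<forall>\<^sub>F u in nhds 0. y u = octahedral n m u"
    if "frobenius_solution_zero (P_cx (of_int n) (of_int m)) (Q_cx (of_int n) (of_int m)) 0 y"
    using that regular_rational_analytic[OF octahedral_germ(1)] sol_disc_eventually[OF octahedral_germ(2)] octahedral_germ(3)
    unfolding frobenius_solution_zero_def
    by (intro frobenius_unique_0[where N = "of_int n" and m = m]) (simp_all add: numeral_2_eq_2)
qed

theorem theorem6p1:
  fixes n m :: int
  defines "N \<equiv> (of_int n :: complex)" and "M \<equiv> (of_int m :: complex)"
    and "P \<equiv> P_oct n m" and "Q \<equiv> Q_oct n m"
    and "b1 \<equiv> complex_of_real (- ((2 + sqrt 3) ^ 2))"
    and "b2 \<equiv> complex_of_real (- ((2 - sqrt 3) ^ 2))"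
  shows
    "fuchsian P Q \<and>
     solves_ode P Q (- {0, 1, b1, b2}) (octahedral n m) \<and>
     char_exponents P Q 0 0 (1/4 + M) \<and>
     char_exponents P Q 1 0 (1 + 4 * M) \<and>
     char_exponents P Q b1 0 (1 + 3 * N) \<and>
     char_exponents P Q b2 0 (1 + 3 * N) \<and>
     char_exponents_inf P Q (- 1/4 - 3 * M - 3 * N) (- 2 * M - 3 * N) \<and>
     (\<forall>a. a \<notin> {0, 1, b1, b2} \<longrightarrow> ordinary_point P Q a) \<and>
     frobenius_solution_zero P Q 0 (octahedral n m) \<and>
     (\<forall>y. frobenius_solution_zero P Q 0 y \<longrightarrow> (\<forall>\<^sub>F u in nhds 0. y u = octahedral n m u)) \<and>
     octahedral_recurrence n m (0, 1)
       (- 1 - 4 * M, 0, 5/8 + 3/2 * M - 3/2 * N) (1, 0, 1)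
       (- (1 + 4 * M)) \<and>
     octahedral_recurrence n m (0, - 1)
       (0, 0, - 1/8 - 3/2 * M - 3/2 * N) (- 3, 0, 1)
       (3 * (1 + 12 * M + 12 * N) * (7 - 12 * M + 12 * N) / (4 * M - 3)) \<and>
     octahedral_recurrence n m (1, 0)
       (7/6 - 2 * M + 2 * N, 0, - 1 - 3 * N) (1, 0, 1)
       (1/6 * (7 - 12 * M + 12 * N)) \<and>
     octahedral_recurrence n m (- 1, 0)
       (- 1/6 - 2 * M - 2 * N, 0, 0) (1, 0, - 2)
       (- (1/6) * (1 + 12 * M + 12 * N)) \<and>
     octahedral_recurrence n m (1, 1)
       (- 1 - 4 * M, 13/12 + M + N, - 1 - 3 * N) (1, 1, 1)
       (- (1 + 4 * M)) \<and>
     octahedral_recurrence n m (- 1, - 1)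
       (0, - 1/12 - M - N, 0) (- 3, 1, - 2)
       (3 * (1 + 12 * M + 12 * N) * (- 11 + 12 * M + 12 * N) / (4 * M - 3)) \<and>
     octahedral_recurrence n m (- 1, 1)
       (- 1 - 4 * M, 5/12 + M - N, 0) (1, 1, - 2)
       (- (1 + 4 * M)) \<and>
     octahedral_recurrence n m (1, - 1)
       (0, 7/12 - M + N, - 1 - 3 * N) (- 3, 1, 1)
       (3 * (- 7 + 12 * M - 12 * N) * (- 19 + 12 * M - 12 * N) / (4 * M - 3))"
proof -
  have PQ: "P = P_cx N M" "Q = Q_cx N M"
    unfolding P_def Q_def N_def M_def by (simp_all add: fun_eq_iff P_oct_eq Q_oct_eq)
  have roots: "p_f u = (u - b1) * (u - b2)" "p_f u = (u - b2) * (u - b1)" for u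
    unfolding p_f_roots b1_def b2_def by simp_all
  have b: "b1 \<noteq> b2" "b1 \<noteq> 0" "b1 \<noteq> 1" "b2 \<noteq> 0" "b2 \<noteq> 1"
  proof -
    have "p_f 0 \<noteq> 0" "p_f 1 \<noteq> 0" by (simp_all add: p_f_def)
    thus "b1 \<noteq> 0" "b1 \<noteq> 1" "b2 \<noteq> 0" "b2 \<noteq> 1" unfolding roots by auto
    have "(2 + sqrt 3) ^ 2 - (2 - sqrt 3) ^ 2 = 8 * sqrt 3" by (simp add: power2_eq_square algebra_simps)
    hence "(2 + sqrt 3) ^ 2 \<noteq> (2 - sqrt 3) ^ 2" by auto
    thus "b1 \<noteq> b2" unfolding b1_def b2_def of_real_eq_iff by simp
  qed
  have fin: "finite {0, 1, b1, b2}" by simp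
  have reg: "- {0, 1, b1, b2} = reg - {0}"
    by (auto simp: reg_def roots(1))
  have ord: "ordinary_point P Q a" if "a \<notin> {0, 1, b1, b2}" for a
    unfolding PQ using that by (intro ordinary_point_cx) (auto simp: roots(1))
  note exps = char_exponents_0[of N M] char_exponents_1[of N M]
    char_exponents_root[OF roots(1) b(1-3), of N M]
    char_exponents_root[OF roots(2) b(1)[symmetric] b(4,5), of N M]
    char_exponents_inf_cx[of N M]
  have fuchs: "fuchsian P Q"
    unfolding fuchsian_def
  proof (intro conjI allI)
    fix a
    show "\<exists>I. has_indicial_poly P Q a I"
    proof (cases "a \<in> {0, 1, b1, b2}")
      case True
      thus ?thesis using exps(1-4) unfolding PQ char_exponents_def by blast
    next
      case False
      thus ?thesis by (intro indicial_of_ordinary ord)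
    qed
    show "\<exists>I. has_indicial_poly (P_inf P) (Q_inf Q) 0 I"
      using exps(5) unfolding PQ char_exponents_inf_def char_exponents_def by blast
  qed (simp_all add: PQ rational_coefficient_cx)
  note sol = solves_ode_octahedral[OF reg fin, of n m, folded N_def M_def, folded PQ]
  note frob = frobenius_octahedral[of n m, folded N_def M_def, folded PQ]
  note steps = octahedral_germ_m_up octahedral_germ_m_down octahedral_germ_n_up octahedral_germ_n_down
    octahedral_germ_nm_up octahedral_germ_nm_down
    octahedral_germ_n_down_m_up octahedral_germ_n_up_m_down
  \<comment> \<open>Each existence statement for a shifted germ becomes a statement about
    \<open>octahedral\<close>, as a germ determines it, and then a recurrence.\<close>
  note rec = steps[OF octahedral_germ_octahedral[of n m], folded N_def M_def,
    THEN octahedral_step, THEN octahedral_recurrenceI]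
  show ?thesis
    by (intro conjI allI impI fuchs sol exps[folded PQ] ord frob) (assumption | (rule rec; simp))+
qed

end
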